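(* Let $\alpha>-1$ and $p_0(\alpha)<p<p_1(\alpha)$. Then for every $f\in B_{p,\alpha}$, $P_r f$ and $W_r f$ converge to $f$ almost everywhere on $(0,\infty)$ as $r\to1^-$.
   Context: For $\alpha>-1$, $d\mu_\alpha(x)=x^{2\alpha+1}\,dx$ on $(0,\infty)$, and $L^p(d\mu_\alpha)=L^p((0,\infty),d\mu_\alpha)$. $J_\nu$ is the Bessel function of the first kind of order $\nu$. For $n=0,1,2,\dots$, $$j_n^\alpha(x)=\sqrt{2(\alpha+2n+1)}\,J_{\alpha+2n+1}(x)\,x^{-\alpha-1},\qquad x>0,$$ which form an orthonormal system in $L^2(d\mu_\alpha)$. The exponents are: $p_0(\alpha)=\frac{4(\alpha+1)}{2\alpha+3}$ and $p_1(\alpha)=\frac{4(\alpha+1)}{2\alpha+1}$ if $\alpha\ge-1/2$ (with $p_1(-1/2)=\infty$); $p_0(\alpha)=1$ and $p_1(\alpha)=\infty$ if $-1<\alpha<-1/2$. For $p_0(\alpha)<p<p_1(\alpha)$, each $j_n^\alpha$ lies in both $L^p(d\mu_\alpha)$ and $L^{p'}(d\mu_\alpha)$ (where $1/p+1/p'=1$), and for $f\in L^p(d\mu_\alpha)$ the Fourier coefficients are $$c_n^\alpha(f)=\int_0^\infty f(y)\,j_n^\alpha(y)\,y^{2\alpha+1}\,dy.$$ $B_{p,\alpha}$ denotes the closure in $L^p(d\mu_\alpha)$ of the linear span of $\{j_n^\alpha\}_{n=0}^\infty$. For $f\in L^p(d\mu_\alpha)$, $0<r<1$, $x>0$, $$P_r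 f(x)=\sum_{n=0}^\infty r^{\alpha+2n+1}c_n^\alpha(f)j_n^\alpha(x),\qquad W_r f(x)=\sum_{n=0}^\infty r^{(\alpha+2n+1)^2}c_n^\alpha(f)j_n^\alpha(x).$$ *)

theory Defs
  imports "HOL-Analysis.Analysis"
begin

text \<open>Only used for \<open>x > 0\<close> and real order; \<open>rGamma = 1 / Gamma\<close> vanishes at the poles of \<open>Gamma\<close>.\<close>

definition bessel_J :: "real \<Rightarrow> real \<Rightarrow> real" where
  "bessel_J \<nu> x =
     (\<Sum>k. (- 1) ^ k / fact k * rGamma (\<nu> + real k + 1) * (x / 2) powr (2 * real k + \<nu>))"

definition mu :: "real \<Rightarrow> real measure" where
  "mu \<alpha> = density (lebesgue_on {0<..}) (\<lambda>x. ennreal (x powr (2 * \<alpha> + 1)))"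

text \<open>Elements of \<open>L\<^sup>p\<close> are represented by functions, not by classes modulo null sets.\<close>

definition Lp_space :: "'a measure \<Rightarrow> real \<Rightarrow> ('a \<Rightarrow> complex) set" where
  "Lp_space M p = {f \<in> borel_measurable M. integrable M (\<lambda>x. norm (f x) powr p)}"

definition Lp_norm :: "'a measure \<Rightarrow> real \<Rightarrow> ('a \<Rightarrow> complex) \<Rightarrow> real" where
  "Lp_norm M p f = (\<integral>x. norm (f x) powr p \<partial>M) powr (1 / p)"

definition Lp_closure :: "'a measure \<Rightarrow> real \<Rightarrow> ('a \<Rightarrow> complex) set \<Rightarrow> ('a \<Rightarrow> complex) set" where
  "Lp_closure M p S =
     {f \<in> Lp_space M p. \<forall>\<epsilon>>0. \<exists>g \<in> S \<inter> Lp_space M p. Lp_norm M p (\<lambda>x. f x - g x) < \<epsilon>}"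

definition jn :: "real \<Rightarrow> nat \<Rightarrow> real \<Rightarrow> real" where
  "jn \<alpha> n x =
     sqrt (2 * (\<alpha> + 2 * real n + 1)) * bessel_J (\<alpha> + 2 * real n + 1) x * x powr (- \<alpha> - 1)"

definition jn_span :: "real \<Rightarrow> (real \<Rightarrow> complex) set" where
  "jn_span \<alpha> = {g. \<exists>N (a :: nat \<Rightarrow> complex). g = (\<lambda>x. \<Sum>n<N. a n * of_real (jn \<alpha> n x))}"

definition B_space :: "real \<Rightarrow> real \<Rightarrow> (real \<Rightarrow> complex) set" where
  "B_space p \<alpha> = Lp_closure (mu \<alpha>) p (jn_span \<alpha>)"

definition p0 :: "real \<Rightarrow> real" where
  "p0 \<alpha> = (if \<alpha> \<ge> - 1 / 2 then 4 * (\<alpha> + 1) / (2 * \<alpha> + 3) else 1)"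

text \<open>At \<open>\<alpha> = -1/2\<close> the formula \<open>4 (\<alpha> + 1) / (2 \<alpha> + 1)\<close> is read as \<open>\<infinity>\<close>.\<close>

definition p1 :: "real \<Rightarrow> ereal" where
  "p1 \<alpha> = (if \<alpha> > - 1 / 2 then ereal (4 * (\<alpha> + 1) / (2 * \<alpha> + 1)) else \<infinity>)"

definition coef :: "real \<Rightarrow> (real \<Rightarrow> complex) \<Rightarrow> nat \<Rightarrow> complex" where
  "coef \<alpha> f n = (\<integral>y. f y * of_real (jn \<alpha> n y) \<partial>mu \<alpha>)"

definition P_mean :: "real \<Rightarrow> real \<Rightarrow> (real \<Rightarrow> complex) \<Rightarrow> real \<Rightarrow> complex" where
  "P_mean \<alpha> r f x =
     (\<Sum>n. of_real (r powr (\<alpha> + 2 * real n + 1)) * coef \<alpha> f n * of_real (jn \<alpha> n x))"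

definition W_mean :: "real \<Rightarrow> real \<Rightarrow> (real \<Rightarrow> complex) \<Rightarrow> real \<Rightarrow> complex" where
  "W_mean \<alpha> r f x =
     (\<Sum>n. of_real (r powr ((\<alpha> + 2 * real n + 1)\<^sup>2)) * coef \<alpha> f n * of_real (jn \<alpha> n x))"

end

theory Submission
  imports Defs
begin

text \<open>
  The series \<open>S f(x) = \<Sum>n. c_n(f) j_n(x)\<close> converges absolutely for every \<open>f \<in> L\<^sup>p\<close> and every
  \<open>x > 0\<close>: the norms of \<open>j_n\<close> in the dual space grow at most exponentially in \<open>n\<close>, while
  \<open>j_n(x)\<close> decays faster than any exponential. Dominated convergence then gives
  \<open>P_r f(x) \<rightarrow> S f(x)\<close> and \<open>W_r f(x) \<rightarrow> S f(x)\<close> at every point. By orthonormality \<open>S g = g\<close> on the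
  span of the \<open>j_n\<close>; if \<open>g_k \<rightarrow> f\<close> in \<open>L\<^sup>p\<close>, then \<open>g_k = S g_k \<rightarrow> S f\<close> pointwise, and Fatou's
  lemma identifies \<open>S f\<close> with \<open>f\<close> almost everywhere. No maximal inequality is needed.
\<close>

section \<open>Bessel functions: recurrences and bounds\<close>

text \<open>The Bessel estimates may be crude in the order but not in the variable. At fixed x the
  factor (x/2)^\<nu> / Gamma(\<nu>+1) beats every exponential in \<nu>, so bounds valid for all x
  may lose a factor exponential in \<nu>. The decay x^(-1/2) must be kept: it makes j_n of size
  x^(-\<alpha>-3/2), and q-integrability of that power at infinity against x^(2\<alpha>+1) reads q
  (\<alpha>+3/2) > 2\<alpha>+2. For q = p/(p-1) this is p (2\<alpha>+1) < 4 (\<alpha>+1), that is p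
  < p_1; the assumption p > p_0 gives p > 1, so q is finite. The obstacle is that decay and
  orthonormality are classically read off from asymptotic expansions and tabulated integrals. Here
  the decay comes from an energy estimate for the pair J_\<nu>, J_{\<nu>+1}, the boundary terms in
  the orthogonality relation from the three-term recurrence, and the normalisation from an average
  over dilations.\<close>

text \<open>
  The Bessel-Clifford function, for which \<open>J_\<nu>(x) = (x/2)\<^sup>\<nu> clifford \<nu> (-x\<^sup>2/4)\<close>.
\<close>

definition clifford :: "real \<Rightarrow> real \<Rightarrow> real" where
  "clifford \<nu> z = (\<Sum>k. rGamma (\<nu> + real k + 1) / fact k * z ^ k)"

lemma rGamma_pos: "x > 0 \<Longrightarrow> rGamma x > (0::real)"
  by (simp add: rGamma_inverse_Gamma Gamma_real_pos)

text \<open>Gamma(\<nu>+k+1) / Gamma(\<nu>+1) is the product of \<nu>+1, ..., \<nu>+k, each factor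
  at least \<nu>+1. Keeping (\<nu>+1)^k rather than 1 puts \<nu>+1 under \<bar>z\<bar> in the
  resulting exponential, so for x of order \<nu> the exponent x^2 / (4 (\<nu>+1)) grows only
  linearly in \<nu>.\<close>

lemma rGamma_shift_le:
  fixes \<nu> :: real
  assumes "\<nu> \<ge> 0"
  shows "rGamma (\<nu> + real k + 1) \<le> rGamma (\<nu> + 1) / (\<nu> + 1) ^ k"
proof (induction k)
  case (Suc k)
  have "rGamma (\<nu> + real k + 1) = (\<nu> + real k + 1) * rGamma (\<nu> + real (Suc k) + 1)"
    using rGamma_plus1[of "\<nu> + real k + 1"] by (simp add: algebra_simps)
  moreover have "rGamma (\<nu> + real (Suc k) + 1) \<ge> 0"
    using assms by (intro less_imp_le rGamma_pos) auto
  ultimately have "(\<nu> + 1) * rGamma (\<nu> + real (Suc k) + 1) \<le> rGamma (\<nu> + real k + 1)"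
    using assms by (auto intro!: mult_right_mono)
  with Suc have "(\<nu> + 1) * rGamma (\<nu> + real (Suc k) + 1) \<le> rGamma (\<nu> + 1) / (\<nu> + 1) ^ k"
    by linarith
  moreover have "(\<nu> + 1) ^ k > 0" "(\<nu> + 1) ^ Suc k > 0" using assms by auto
  ultimately show ?case by (simp add: pos_le_divide_eq mult_ac)
qed auto

lemma clifford_term_le:
  assumes "\<nu> \<ge> 0"
  shows "norm (rGamma (\<nu> + real k + 1) / fact k * z ^ k)
         \<le> rGamma (\<nu> + 1) * (inverse (fact k) * (\<bar>z\<bar> / (\<nu> + 1)) ^ k)"
proof -
  have "rGamma (\<nu> + real k + 1) \<ge> 0" 
    using assms by (intro less_imp_le rGamma_pos) auto
  then have "norm (rGamma (\<nu> + real k + 1) / fact k * z ^ k) = rGamma (\<nu> + real k + 1) * (\<bar>z\<bar> ^ k / fact k)"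
    by (simp add: abs_mult power_abs)
  also have "\<dots> \<le> rGamma (\<nu> + 1) / (\<nu> + 1) ^ k * (\<bar>z\<bar> ^ k / fact k)"
    using rGamma_shift_le[OF assms] by (intro mult_right_mono) auto
  finally show ?thesis by (simp add: field_simps)
qed

lemma clifford_summable_norm:
  assumes "\<nu> \<ge> 0"
  shows "summable (\<lambda>k. norm (rGamma (\<nu> + real k + 1) / fact k * z ^ k))"
proof (rule summable_comparison_test')
  show "summable (\<lambda>k. rGamma (\<nu> + 1) * (inverse (fact k) * (\<bar>z\<bar> / (\<nu> + 1)) ^ k))"
    by (intro summable_mult summable_exp)
qed (use clifford_term_le[OF assms] in simp)

lemma clifford_summable:
  "\<nu> \<ge> 0 \<Longrightarrow> summable (\<lambda>k. rGamma (\<nu> + real k + 1) / fact k * z ^ k)"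
  by (rule summable_norm_cancel) (rule clifford_summable_norm)

lemma abs_clifford_le:
  assumes "\<nu> \<ge> 0"
  shows "\<bar>clifford \<nu> z\<bar> \<le> rGamma (\<nu> + 1) * exp (\<bar>z\<bar> / (\<nu> + 1))"
proof -
  have s: "(\<lambda>k. rGamma (\<nu> + 1) * (inverse (fact k) * (\<bar>z\<bar> / (\<nu> + 1)) ^ k)) sums
      (rGamma (\<nu> + 1) * exp (\<bar>z\<bar> / (\<nu> + 1)))"
    using exp_converges[of "\<bar>z\<bar> / (\<nu> + 1)"] by (intro sums_mult) (simp add: divide_inverse)
  have "norm (clifford \<nu> z) \<le> (\<Sum>k. norm (rGamma (\<nu> + real k + 1) / fact k * z ^ k))"
    unfolding clifford_def by (rule summable_norm[OF clifford_summable_norm[OF assms]])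
  also have "\<dots> \<le> (\<Sum>k. rGamma (\<nu> + 1) * (inverse (fact k) * (\<bar>z\<bar> / (\<nu> + 1)) ^ k))"
    using clifford_term_le[OF assms] clifford_summable_norm[OF assms] sums_summable[OF s]
    by (intro suminf_le) auto
  finally show ?thesis using sums_unique[OF s] by simp
qed

lemma DERIV_clifford:
  assumes "\<nu> \<ge> 0"
  shows "(clifford \<nu> has_field_derivative clifford (\<nu> + 1) z) (at z)"
proof -
  have d: "diffs (\<lambda>k. rGamma (\<nu> + real k + 1) / fact k) k
      = rGamma (\<nu> + 1 + real k + 1) / fact k" for k
  proof -
    have "(fact (Suc k) :: real) = (1 + real k) * fact k" by (simp add: algebra_simps)
    then show ?thesis unfolding diffs_def by (simp add: add_ac divide_simps del: fact_Suc)
  qed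
  show ?thesis
    using termdiffs_strong_converges_everywhere[of "\<lambda>k. rGamma (\<nu> + real k + 1) / fact k" z]
      clifford_summable[OF assms]
    unfolding clifford_def[abs_def] d by simp
qed

text \<open>In rGamma(\<nu>+k+1) = (\<nu>+1+k) rGamma(\<nu>+k+2) the part \<nu>+1 produces the first
  term; the part k cancels against k! and shifts the index, producing the second.\<close>

lemma clifford_rec:
  assumes "\<nu> \<ge> 0"
  shows "clifford \<nu> z = (\<nu> + 1) * clifford (\<nu> + 1) z + z * clifford (\<nu> + 2) z"
proof -
  let ?a = "\<lambda>k. rGamma (\<nu> + 1 + real k + 1) / fact k * z ^ k"
  let ?b = "\<lambda>k. rGamma (\<nu> + 2 + real k + 1) / fact k * z ^ k"
  have a: "?a sums clifford (\<nu> + 1) z" 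
    using clifford_summable[of "\<nu>+1"] assms unfolding clifford_def by (simp add: summable_sums)
  have k: "real (Suc k) * ?a (Suc k) = z * ?b k" for k
  proof -
    have "(fact (Suc k) :: real) = real (Suc k) * fact k" by (simp add: algebra_simps)
    then show ?thesis by (simp add: add_ac divide_simps del: fact_Suc of_nat_Suc) (simp add: add_ac)
  qed
  have "(\<lambda>k. real (Suc k) * ?a (Suc k)) sums (z * clifford (\<nu> + 2) z)"
    unfolding k using clifford_summable[of "\<nu>+2"] assms unfolding clifford_def 
    by (intro sums_mult summable_sums) simp
  \<comment> \<open>The term at \<open>k = 0\<close> vanishes, so undoing the shift adds
    nothing.\<close>
  then have b: "(\<lambda>k. real k * ?a k) sums (z * clifford (\<nu> + 2) z)"
    using sums_Suc_iff[of "\<lambda>k. real k * ?a k"] by simp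
  have e: "(\<nu> + 1) * ?a k + real k * ?a k = rGamma (\<nu> + real k + 1) / fact k * z ^ k" for k
  proof -
    have "rGamma (\<nu> + real k + 1) = (\<nu> + 1 + real k) * rGamma (\<nu> + 1 + real k + 1)"
      using rGamma_plus1[of "\<nu> + real k + 1"] by (simp add: add_ac)
    then show ?thesis by (simp add: algebra_simps add_divide_distrib)
  qed
  have "(\<lambda>k. rGamma (\<nu> + real k + 1) / fact k * z ^ k) sums ((\<nu> + 1) * clifford (\<nu> + 1) z + z * clifford (\<nu> + 2) z)"
    using sums_add[OF sums_mult[OF a, of "\<nu> + 1"] b] unfolding e .
  then show ?thesis unfolding clifford_def by (rule sums_unique[symmetric])
qed

lemma bessel_J_clifford:
  assumes "\<nu> \<ge> 0" "x > 0"
  shows "bessel_J \<nu> x = (x / 2) powr \<nu> * clifford \<nu> (- (x\<^sup>2 / 4))"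
proof -
  have "(- 1) ^ k / fact k * rGamma (\<nu> + real k + 1) * (x / 2) powr (2 * real k + \<nu>)
      = (x / 2) powr \<nu> * (rGamma (\<nu> + real k + 1) / fact k * (- (x\<^sup>2 / 4)) ^ k)" for k
  proof -
    have "(x / 2) powr (2 * real k + \<nu>) = (x / 2) ^ (2 * k) * (x / 2) powr \<nu>"
      using assms powr_realpow[of "x/2" "2 * k"] by (simp add: powr_add)
    moreover have "(- (x\<^sup>2 / 4)) ^ k = (- 1) ^ k * (x / 2) ^ (2 * k)"
      by (subst power_minus) (simp add: power_mult power_divide)
    ultimately show ?thesis by simp
  qed
  then show ?thesis unfolding bessel_J_def clifford_def
    using suminf_mult[OF clifford_summable[OF assms(1)]] by presburger
qed

lemma bessel_J_rec:
  assumes "\<nu> \<ge> 0" "x > 0"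
  shows "bessel_J \<nu> x + bessel_J (\<nu> + 2) x = 2 * (\<nu> + 1) / x * bessel_J (\<nu> + 1) x"
proof -
  have "(x / 2) powr (\<nu> + 2) = (x / 2) powr \<nu> * (x\<^sup>2 / 4)"
    using assms powr_realpow[of "x/2" 2] by (simp add: powr_add power_divide)
  moreover have "(x / 2) powr (\<nu> + 1) = (x / 2) powr \<nu> * (x / 2)"
    using assms by (simp add: powr_add)
  moreover have "p * ((\<nu> + 1) * c1 + - (x\<^sup>2 / 4) * c2) + p * (x\<^sup>2 / 4) * c2
      = 2 * (\<nu> + 1) / x * (p * (x / 2) * c1)" for p c1 c2
    using assms by (simp add: field_simps)
  moreover have "bessel_J \<nu> x = (x / 2) powr \<nu> * ((\<nu> + 1) * clifford (\<nu> + 1) (- (x\<^sup>2 / 4))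
      + - (x\<^sup>2 / 4) * clifford (\<nu> + 2) (- (x\<^sup>2 / 4)))"
    using assms by (simp only: bessel_J_clifford clifford_rec[OF assms(1), of "- (x\<^sup>2 / 4)"])
  moreover have "bessel_J (\<nu> + 1) x = (x / 2) powr (\<nu> + 1) * clifford (\<nu> + 1) (- (x\<^sup>2 / 4))"
    "bessel_J (\<nu> + 2) x = (x / 2) powr (\<nu> + 2) * clifford (\<nu> + 2) (- (x\<^sup>2 / 4))"
    using assms by (auto intro!: bessel_J_clifford)
  ultimately show ?thesis by (simp only:)
qed

lemma DERIV_bessel_J:
  assumes "\<nu> \<ge> 0" "x > 0"
  shows "(bessel_J \<nu> has_field_derivative \<nu> / x * bessel_J \<nu> x - bessel_J (\<nu> + 1) x) (at x)"
proof (rule has_field_derivative_transform_within_open)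
  have p: "(x / 2) powr (\<nu> + 1) = (x / 2) powr \<nu> * (x / 2)" "(x / 2) powr (\<nu> - 1) = (x / 2) powr \<nu> / (x / 2)"
    using assms by (simp_all add: powr_add powr_diff)
  show "((\<lambda>x. (x / 2) powr \<nu> * clifford \<nu> (- (x\<^sup>2 / 4))) has_field_derivative
      \<nu> / x * bessel_J \<nu> x - bessel_J (\<nu> + 1) x) (at x)"
    using assms
    by (auto intro!: derivative_eq_intros DERIV_chain2[OF DERIV_clifford] simp: bessel_J_clifford p)
      (simp add: field_simps)
  show "open {0::real<..}" "x \<in> {0<..}" using assms by auto
qed (use assms in \<open>auto simp: bessel_J_clifford\<close>)

text \<open>The recurrence trades order \<nu>+2 for order \<nu>; together with
  \<open>DERIV_bessel_J\<close> the orders \<nu> and \<nu>+1 then satisfy a closed first-order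
  system.\<close>

lemma DERIV_bessel_J_Suc:
  assumes "\<nu> \<ge> 0" "x > 0"
  shows "(bessel_J (\<nu> + 1) has_field_derivative bessel_J \<nu> x - (\<nu> + 1) / x * bessel_J (\<nu> + 1) x) (at x)"
proof -
  have "(\<nu> + 1) / x * bessel_J (\<nu> + 1) x - bessel_J (\<nu> + 1 + 1) x
      = bessel_J \<nu> x - (\<nu> + 1) / x * bessel_J (\<nu> + 1) x"
    using bessel_J_rec[OF assms] by (simp add: add_ac add_divide_distrib ring_distribs)
  moreover have "(bessel_J (\<nu> + 1) has_field_derivative
      (\<nu> + 1) / x * bessel_J (\<nu> + 1) x - bessel_J (\<nu> + 1 + 1) x) (at x)"
    using assms by (intro DERIV_bessel_J) auto
  ultimately show ?thesis by (simp only:)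
qed

section \<open>Size of J_\<nu>: exponential in the order, x^(-1/2) in the variable\<close>

lemma powr_rGamma_le:
  assumes "y \<ge> 0" "\<nu> \<ge> 0"
  shows "y powr \<nu> * rGamma (\<nu> + 1) \<le> exp (y::real)"
proof -
  \<comment> \<open>Gamma(\<nu>+1) is at least its integral over t \<ge> y, and there t^\<nu> \<ge>
    y^\<nu>.\<close>
  have "((\<lambda>t. y powr \<nu> * exp (- 1 * t)) has_integral y powr \<nu> * (exp (- 1 * y) / 1)) {y..}"
    by (intro has_integral_mult_right has_integral_exp_minus_to_infinity) simp
  then have i1: "((\<lambda>t. if t \<in> {y..} then y powr \<nu> * exp (- t) else 0) has_integral y powr \<nu> * exp (- y)) {0..}"
    using assms by (subst has_integral_restrict) auto
  have i2: "((\<lambda>t. t powr \<nu> / exp t) has_integral Gamma (\<nu> + 1)) {0..}"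
    using Gamma_integral_real[of "\<nu> + 1"] assms by simp
  have "y powr \<nu> * exp (- y) \<le> Gamma (\<nu> + 1)"
    by (rule has_integral_le[OF i1 i2]) (use assms in \<open>auto simp: exp_minus divide_inverse intro!: powr_mono2 mult_right_mono\<close>)
  moreover have "Gamma (\<nu> + 1) > 0" using assms by (intro Gamma_real_pos) auto
  ultimately show ?thesis by (simp add: rGamma_inverse_Gamma exp_minus field_simps)
qed

lemma abs_bessel_J_le:
  assumes "\<nu> \<ge> 0" "x > 0"
  shows "\<bar>bessel_J \<nu> x\<bar> \<le> (x / 2) powr \<nu> * rGamma (\<nu> + 1) * exp (x\<^sup>2 / (4 * (\<nu> + 1)))"
  using mult_left_mono[OF abs_clifford_le[OF assms(1), of "- (x\<^sup>2 / 4)"], of "(x / 2) powr \<nu>"] assms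
  by (simp add: bessel_J_clifford abs_mult mult_ac)

text \<open>On this range the power factor is at most exp(x/2) and the exponential factor at most
  exp(\<nu>+1). Both orders are bounded up to 2\<nu>+1 because the energy estimate starts at that
  point and involves both.\<close>

lemma abs_bessel_J_le_exp:
  assumes "\<nu> \<ge> 0" "x > 0" "x \<le> 2 * \<nu> + 1"
  shows "\<bar>bessel_J \<nu> x\<bar> \<le> exp (2 * \<nu> + 2)" "\<bar>bessel_J (\<nu> + 1) x\<bar> \<le> exp (2 * \<nu> + 2)"
proof -
  have x2: "x\<^sup>2 \<le> (2 * \<nu> + 2)\<^sup>2" using assms by (intro power_mono) auto
  have *: "\<bar>bessel_J \<mu> x\<bar> \<le> exp (2 * \<nu> + 2)" if "\<mu> \<ge> \<nu>" for \<mu>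
  proof -
    have "\<mu> \<ge> 0" using that assms by simp
    have "(x / 2) powr \<mu> * rGamma (\<mu> + 1) \<le> exp (x / 2)"
      using \<open>\<mu> \<ge> 0\<close> assms by (intro powr_rGamma_le) auto
    moreover have "x\<^sup>2 / (4 * (\<mu> + 1)) \<le> (2 * \<nu> + 2)\<^sup>2 / (4 * (\<nu> + 1))"
      using that assms x2 by (intro frac_le) auto
    moreover have "(2 * \<nu> + 2)\<^sup>2 / (4 * (\<nu> + 1)) = \<nu> + 1"
      using assms by (simp add: field_simps power2_eq_square)
    ultimately have "(x / 2) powr \<mu> * rGamma (\<mu> + 1) * exp (x\<^sup>2 / (4 * (\<mu> + 1))) \<le> exp (x / 2) * exp (\<nu> + 1)"
      by (intro mult_mono) auto
    also have "\<dots> \<le> exp (2 * \<nu> + 2)" using assms by (simp flip: exp_add)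
    finally show ?thesis using abs_bessel_J_le[of \<mu> x] \<open>\<mu> \<ge> 0\<close> assms by linarith
  qed
  show "\<bar>bessel_J \<nu> x\<bar> \<le> exp (2 * \<nu> + 2)" "\<bar>bessel_J (\<nu> + 1) x\<bar> \<le> exp (2 * \<nu> + 2)"
    by (intro *; simp)+
qed

lemma bessel_J_energy_le:
  assumes "\<nu> \<ge> 0" "x \<ge> 2 * \<nu> + 1"
  shows "x * ((bessel_J \<nu> x)\<^sup>2 + (bessel_J (\<nu> + 1) x)\<^sup>2) \<le> exp (6 * \<nu> + 8)"
proof -
  define c where "c = 2 * \<nu> + 1"
  have c: "c \<ge> 1" using assms by (simp add: c_def)
  define a b where "a = bessel_J \<nu>" and "b = bessel_J (\<nu> + 1)"
  \<comment> \<open>By the first-order system for \<open>(a, b)\<close>, the derivative of \<open>x (a\<^sup>2 + b\<^sup>2)\<close> is \<open>c (a\<^sup>2 - b\<^sup>2)\<close>; the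
    correction \<open>c a b\<close> cancels this oscillating term, leaving \<open>E' = c a b / x \<le> c E / x\<^sup>2\<close>, a Gronwall estimate.\<close>
  define E where "E = (\<lambda>x. x * ((a x)\<^sup>2 + (b x)\<^sup>2) - c * (a x * b x))"
  \<comment> \<open>Integrating factor for E' \<le> c E / x^2: it makes \<open>F\<close>
    nonincreasing and lies between 1 and exp 1 for x \<ge> c.\<close>
  define F where "F = (\<lambda>x. E x * exp (c / x))"
  have ab: "2 * (a y * b y) \<le> (a y)\<^sup>2 + (b y)\<^sup>2" "- (2 * (a y * b y)) \<le> (a y)\<^sup>2 + (b y)\<^sup>2" for y
    using sum_squares_bound[of "a y" "b y"] sum_squares_bound[of "- a y" "b y"] by (auto simp: algebra_simps)
  \<comment> \<open>For \<open>y \<ge> c\<close> the correction removes at most half of the energy,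
    so a bound on \<open>E\<close> suffices.\<close>
  have E_ge: "y * ((a y)\<^sup>2 + (b y)\<^sup>2) \<le> 2 * E y" if "y \<ge> c" for y
  proof -
    have "c * (2 * (a y * b y)) \<le> c * ((a y)\<^sup>2 + (b y)\<^sup>2)" using ab[of y] c by (intro mult_left_mono) auto
    also have "\<dots> \<le> y * ((a y)\<^sup>2 + (b y)\<^sup>2)" using that by (intro mult_right_mono) auto
    finally show ?thesis by (simp add: E_def)
  qed
  have dE: "(E has_field_derivative c * (a y * b y) / y) (at y)" if "y > 0" for y
    unfolding E_def a_def b_def c_def using that assms
    by (auto intro!: derivative_eq_intros DERIV_bessel_J DERIV_bessel_J_Suc) (simp add: field_simps power2_eq_square)
  have dF: "(F has_field_derivative (c * (a y * b y) / y - c * E y / y\<^sup>2) * exp (c / y)) (at y)" if "y > 0" for y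
    unfolding F_def using that
    by (auto intro!: derivative_eq_intros dE) (simp add: field_simps power2_eq_square)
  have "F x \<le> F c"
  proof (rule DERIV_nonpos_imp_nonincreasing[where f = F])
    show "c \<le> x" using assms by (simp add: c_def)
    fix y assume y: "c \<le> y" "y \<le> x"
    then have "y > 0" using c by linarith
    have "y * (2 * (a y * b y)) \<le> y * ((a y)\<^sup>2 + (b y)\<^sup>2)" using ab[of y] \<open>y > 0\<close> by (intro mult_left_mono) auto
    with E_ge[OF y(1)] have "y * (a y * b y) \<le> E y" by simp
    then have "c * (y * (a y * b y)) \<le> c * E y" using c by (intro mult_left_mono) auto
    then have "c * (a y * b y) / y - c * E y / y\<^sup>2 \<le> 0"
      using \<open>y > 0\<close> by (simp add: field_simps power2_eq_square)
    then show "\<exists>d. (F has_real_derivative d) (at y) \<and> d \<le> 0"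
      using dF[OF \<open>y > 0\<close>] by (intro exI[of _ "(c * (a y * b y) / y - c * E y / y\<^sup>2) * exp (c / y)"])
        (auto intro!: mult_nonpos_nonneg)
  qed
  have "(a c)\<^sup>2 \<le> (exp (2 * \<nu> + 2))\<^sup>2" "(b c)\<^sup>2 \<le> (exp (2 * \<nu> + 2))\<^sup>2"
    using abs_bessel_J_le_exp[of \<nu> c] assms c
    by (auto simp: a_def b_def c_def abs_le_square_iff[symmetric])
  then have le: "(a c)\<^sup>2 + (b c)\<^sup>2 \<le> 2 * exp (4 * \<nu> + 4)" by (simp add: power2_eq_square flip: exp_add)
  have "0 \<le> x * ((a x)\<^sup>2 + (b x)\<^sup>2)" using assms by (intro mult_nonneg_nonneg) auto
  moreover have "x * ((a x)\<^sup>2 + (b x)\<^sup>2) \<le> 2 * E x" using E_ge[of x] assms by (simp add: c_def)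
  ultimately have E0: "E x \<ge> 0" by linarith
  have "E x \<le> F x" unfolding F_def using E0 c assms mult_left_mono[of 1 "exp (c / x)" "E x"] by (simp add: c_def)
  also have "\<dots> \<le> F c" by fact
  also have "F c = E c * exp 1" using c by (simp add: F_def)
  finally have Ec: "E x \<le> E c * exp 1" .
  have "E c \<le> c * ((3 / 2) * ((a c)\<^sup>2 + (b c)\<^sup>2))"
  proof -
    have "- (a c * b c) \<le> ((a c)\<^sup>2 + (b c)\<^sup>2) / 2" using ab(2)[of c] by simp
    then have "c * (- (a c * b c)) \<le> c * (((a c)\<^sup>2 + (b c)\<^sup>2) / 2)" using c by (intro mult_left_mono) auto
    then show ?thesis by (simp add: E_def algebra_simps)
  qed
  \<comment> \<open>The factor \<open>c\<close> = 1 + 2\<nu> is absorbed by exp(2\<nu>).\<close>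
  also have "\<dots> \<le> exp (2 * \<nu>) * ((3 / 2) * (2 * exp (4 * \<nu> + 4)))"
    using le c exp_ge_add_one_self[of "2 * \<nu>", folded c_def] 
    by (intro mult_mono) (auto simp: c_def add.commute)
  also have "\<dots> = 3 * exp (6 * \<nu> + 4)" by (simp flip: exp_add)
  finally have "E c * exp 1 \<le> 3 * exp (6 * \<nu> + 4) * exp 1" by (intro mult_right_mono) auto
  with Ec have "E x \<le> 3 * exp (6 * \<nu> + 4) * exp 1" by linarith
  then have Ex: "E x \<le> 3 * exp (6 * \<nu> + 5)" using exp_add[of "6 * \<nu> + 4" 1] by (simp add: add.commute)
  \<comment> \<open>The constant 6 is 3 from the starting value times 2 from \<open>E_ge\<close>; it
    is absorbed into the exponential.\<close>
  have "(2::real) ^ 3 \<le> exp 1 ^ 3" using exp_ge_add_one_self[of 1] by (intro power_mono) auto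
  also have "exp (1::real) ^ 3 = exp 3" using exp_of_nat_mult[of 3 "1::real"] by simp
  finally have e3: "6 \<le> exp (3::real)" by simp
  have "x * ((a x)\<^sup>2 + (b x)\<^sup>2) \<le> 6 * exp (6 * \<nu> + 5)" using Ex E_ge[of x] assms by (simp add: c_def)
  also have "\<dots> \<le> exp 3 * exp (6 * \<nu> + 5)" using e3 by (intro mult_right_mono) auto
  also have "\<dots> = exp (6 * \<nu> + 8)" by (simp flip: exp_add)
  finally show ?thesis by (simp add: a_def b_def)
qed

text \<open>The series controls x < 2\<nu>+1, where x itself is below exp(2\<nu>); the energy
  estimate controls the rest. The exponent 3\<nu>+4 is half of the one for the energy.\<close>

lemma bessel_J_decay:
  assumes "\<nu> \<ge> 0" "x > 0"
  shows "\<bar>bessel_J \<nu> x\<bar> \<le> exp (3 * \<nu> + 4) * x powr (- 1 / 2)"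
proof -
  have "x * (bessel_J \<nu> x)\<^sup>2 \<le> exp (6 * \<nu> + 8)"
  proof (cases "x \<ge> 2 * \<nu> + 1")
    case True
    have "x * (bessel_J \<nu> x)\<^sup>2 \<le> x * ((bessel_J \<nu> x)\<^sup>2 + (bessel_J (\<nu> + 1) x)\<^sup>2)"
      using assms by (intro mult_left_mono) auto
    with bessel_J_energy_le[OF assms(1) True] show ?thesis by linarith
  next
    case False
    have "x \<le> exp (2 * \<nu>)" using False exp_ge_add_one_self[of "2 * \<nu>"] by linarith
    then have "x * (bessel_J \<nu> x)\<^sup>2 \<le> exp (2 * \<nu>) * (exp (2 * \<nu> + 2))\<^sup>2"
      using False assms abs_bessel_J_le_exp(1)[OF assms]
      by (intro mult_mono) (auto simp: abs_le_square_iff[symmetric])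
    also have "\<dots> \<le> exp (6 * \<nu> + 8)" by (simp add: power2_eq_square flip: exp_add)
    finally show ?thesis .
  qed
  also have "exp (6 * \<nu> + 8) = (exp (3 * \<nu> + 4))\<^sup>2" by (simp add: power2_eq_square flip: exp_add)
  also have "\<dots> = x * (exp (3 * \<nu> + 4) * x powr (- 1 / 2))\<^sup>2"
    using assms powr_add[of x "- 1 / 2" "- 1 / 2"] by (simp add: power2_eq_square powr_minus divide_simps)
  finally have "(bessel_J \<nu> x)\<^sup>2 \<le> (exp (3 * \<nu> + 4) * x powr (- 1 / 2))\<^sup>2"
    using assms by simp
  then show ?thesis using abs_le_square_iff[of "bessel_J \<nu> x" "exp (3 * \<nu> + 4) * x powr (- 1 / 2)"]
    by (simp add: abs_mult)
qed

section \<open>The integral of \<open>J_\<nu>(x)\<^sup>2 / x\<close>\<close>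

lemma Gamma_duplication_real:
  assumes "a > (0::real)"
  shows "Gamma (2 * a + 1) = 4 powr a * Gamma (a + 1) * Gamma (a + 1 / 2) / sqrt pi"
proof -
  have "complex_of_real a \<notin> \<int>\<^sub>\<le>\<^sub>0" "complex_of_real a + 1 / 2 \<notin> \<int>\<^sub>\<le>\<^sub>0"
    using assms by (auto elim!: nonpos_Ints_cases' simp: complex_eq_iff)
  from Gamma_legendre_duplication[OF this]
  have "complex_of_real (Gamma a * Gamma (a + 1 / 2)) =
      complex_of_real (exp ((1 - 2 * a) * ln 2) * sqrt pi * Gamma (2 * a))"
    by (simp flip: Gamma_complex_of_real exp_of_real)
  then have *: "Gamma a * Gamma (a + 1 / 2) = exp ((1 - 2 * a) * ln 2) * sqrt pi * Gamma (2 * a)"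
    by (simp only: of_real_eq_iff)
  have "exp ((1 - 2 * a) * ln 2) = 2 powr (1 - 2 * a)" by (simp add: powr_def)
  also have "\<dots> = 2 / 4 powr a"
    using powr_powr[of 2 2 a] by (simp add: powr_diff)
  finally have "4 powr a * (Gamma a * Gamma (a + 1 / 2)) = 2 * sqrt pi * Gamma (2 * a)"
    unfolding * by simp
  moreover have "Gamma (2 * a + 1) = 2 * a * Gamma (2 * a)" "Gamma (a + 1) = a * Gamma a"
    using assms by (auto intro!: Gamma_plus1 elim!: nonpos_Ints_cases')
  ultimately show ?thesis by (simp add: field_simps)
qed

text \<open>Taylor coefficients of the square of \<open>clifford \<nu>\<close>: the generalised
  binomial coefficient of 2\<nu>+2n over n, divided by Gamma(\<nu>+n+1)^2. It is written as a Gamma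
  quotient because averaging will cancel \<open>Gamma (2 * \<nu> + real n + 1)\<close>.\<close>

definition clifford_sq_coeff :: "real \<Rightarrow> nat \<Rightarrow> real" where
  "clifford_sq_coeff \<nu> n = Gamma (2 * \<nu> + 2 * real n + 1) /
     (fact n * Gamma (2 * \<nu> + real n + 1) * (Gamma (\<nu> + real n + 1))\<^sup>2)"

lemma clifford_square_sums:
  assumes "\<nu> \<ge> 0"
  shows "(\<lambda>n. clifford_sq_coeff \<nu> n * z ^ n) sums (clifford \<nu> z)\<^sup>2"
proof -
  let ?c = "\<lambda>k. rGamma (\<nu> + real k + 1) / fact k"
  have nn: "x \<notin> \<int>\<^sub>\<le>\<^sub>0" if "x > 0" for x :: real
    using that by (auto elim!: nonpos_Ints_cases')
  have "(\<Sum>i\<le>n. (?c i * z ^ i) * (?c (n - i) * z ^ (n - i))) = clifford_sq_coeff \<nu> n * z ^ n" for n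
  proof -
    \<comment> \<open>With this upper index each \<open>g gchoose k\<close> has the same numerator
      Gamma(g+1), so Vandermonde's convolution becomes the Cauchy product. The reciprocal Gamma
      factor of index n-k comes with \<open>fact k\<close>; multiplying by the coefficient over n-k
      restores the pairing.\<close>
    define g where "g = \<nu> + real n"
    have gb: "g gchoose k = Gamma (g + 1) * (rGamma (\<nu> + real (n - k) + 1) / fact k)" if "k \<le> n" for k
      using that assms by (subst gbinomial_Gamma) (auto simp: g_def of_nat_diff nn rGamma_inverse_Gamma field_simps)
    have "Gamma (1 + (\<nu> + real n)) > 0" using assms by (intro Gamma_real_pos) linarith
    then have "Gamma (1 + (\<nu> + real n)) \<noteq> 0" by linarith
    then have nz: "Gamma (g + 1) \<noteq> 0" by (simp add: g_def add_ac)
    have "clifford_sq_coeff \<nu> n * (Gamma (g + 1))\<^sup>2 = (g + g) gchoose n"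
      using assms \<open>Gamma (1 + (\<nu> + real n)) \<noteq> 0\<close>
      by (subst gbinomial_Gamma) (auto simp: g_def clifford_sq_coeff_def nn add_ac)
    also have "\<dots> = (\<Sum>k\<in>{0..n}. (g gchoose k) * (g gchoose (n - k)))"
      by (rule gbinomial_Vandermonde[symmetric])
    also have "\<dots> = (\<Sum>k\<le>n. (Gamma (g + 1))\<^sup>2 * (?c k * ?c (n - k)))"
      by (intro sum.cong) (auto simp: gb power2_eq_square)
    also have "\<dots> = (\<Sum>k\<le>n. ?c k * ?c (n - k)) * (Gamma (g + 1))\<^sup>2"
      by (subst sum_distrib_right) (simp only: mult.commute)
    finally have "clifford_sq_coeff \<nu> n = (\<Sum>k\<le>n. ?c k * ?c (n - k))"
      using nz by (simp only: mult_right_cancel power_not_zero not_False_eq_True)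
    moreover have "(\<Sum>i\<le>n. (?c i * z ^ i) * (?c (n - i) * z ^ (n - i))) = (\<Sum>i\<le>n. ?c i * ?c (n - i) * z ^ n)"
    proof (rule sum.cong[OF refl])
      fix i assume "i \<in> {..n}"
      then have "z ^ n = z ^ i * z ^ (n - i)" by (simp flip: power_add)
      then show "(?c i * z ^ i) * (?c (n - i) * z ^ (n - i)) = ?c i * ?c (n - i) * z ^ n"
        by (simp only: mult_ac)
    qed
    ultimately show ?thesis by (simp only: sum_distrib_right)
  qed
  then show ?thesis
    using Cauchy_product_sums[OF clifford_summable_norm[OF assms, of z] clifford_summable_norm[OF assms, of z]]
    by (simp add: clifford_def power2_eq_square)
qed

text \<open>The added Gamma factor is the moment produced by averaging over t. Once it cancels,
  duplication turns Gamma(2a+1) / Gamma(a+1)^2 with a = \<nu>+n into a Beta value, hence into a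
  moment of the arcsine weight v^(-1/2) (1-v)^(-1/2).\<close>

lemma clifford_sq_coeff_eq_Beta:
  assumes "\<nu> > 0"
  shows "clifford_sq_coeff \<nu> n * Gamma (2 * \<nu> + real n + 1) = 4 powr (\<nu> + real n) * Beta (\<nu> + real n + 1 / 2) (1 / 2) / (pi * fact n)"
proof -
  define a where "a = \<nu> + real n"
  have a: "a > 0" using assms by (simp add: a_def)
  have p: "Gamma (a + 1) > 0" "Gamma (2 * \<nu> + real n + 1) > 0" using a assms by (auto intro!: Gamma_real_pos)
  have "clifford_sq_coeff \<nu> n * Gamma (2 * \<nu> + real n + 1) = Gamma (2 * a + 1) / (fact n * (Gamma (a + 1))\<^sup>2)"
    using p by (simp add: clifford_sq_coeff_def a_def)
  also have "\<dots> = 4 powr a * Gamma (a + 1 / 2) / (sqrt pi * fact n * Gamma (a + 1))"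
    using p unfolding Gamma_duplication_real[OF a] by (simp add: field_simps power2_eq_square)
  also have "\<dots> = 4 powr a * (Gamma (a + 1 / 2) * sqrt pi / Gamma (a + 1)) / ((sqrt pi * sqrt pi) * fact n)"
    using p by (simp add: field_simps del: real_sqrt_mult_self)
  also have "\<dots> = 4 powr a * Beta (a + 1 / 2) (1 / 2) / (pi * fact n)"
    using arg_cong[OF add.commute[of 1 a], of Gamma] by (simp add: Beta_def Gamma_one_half_real)
  finally show ?thesis by (simp add: a_def)
qed

lemma clifford_sq_coeff_pos: "\<nu> > 0 \<Longrightarrow> clifford_sq_coeff \<nu> n > 0"
  unfolding clifford_sq_coeff_def by (intro divide_pos_pos mult_pos_pos zero_less_power Gamma_real_pos) auto

lemma clifford_sq_coeff_Gamma_summable: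
  assumes "\<nu> > 0" "w \<ge> 0"
  shows "summable (\<lambda>n. clifford_sq_coeff \<nu> n * Gamma (2 * \<nu> + real n + 1) * w ^ n)"
proof (rule summable_comparison_test')
  show "summable (\<lambda>n. 4 powr \<nu> * (inverse (fact n) * (4 * w) ^ n))"
    by (intro summable_mult summable_exp)
  fix n :: nat
  \<comment> \<open>Beta decreases in its first argument, and Beta(1/2, 1/2) = pi is a bound uniform
    in n.\<close>
  have "Beta (\<nu> + real n + 1 / 2) (1 / 2) \<le> Beta (1 / 2) (1 / 2)"
    using assms by (intro Beta_real_mono) auto
  then have B: "Beta (\<nu> + real n + 1 / 2) (1 / 2) \<le> pi"
    by (simp add: Beta_def Gamma_one_half_real)
  have "norm (clifford_sq_coeff \<nu> n * Gamma (2 * \<nu> + real n + 1) * w ^ n) = clifford_sq_coeff \<nu> n * Gamma (2 * \<nu> + real n + 1) * w ^ n"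
    using assms clifford_sq_coeff_pos[of \<nu> n] Gamma_real_pos[of "2 * \<nu> + real n + 1"] by simp
  also have "\<dots> = 4 powr (\<nu> + real n) * w ^ n / (pi * fact n) * Beta (\<nu> + real n + 1 / 2) (1 / 2)"
    by (simp add: clifford_sq_coeff_eq_Beta assms)
  also have "\<dots> \<le> 4 powr (\<nu> + real n) * w ^ n / (pi * fact n) * pi"
    using assms by (intro mult_left_mono B) auto
  also have "\<dots> = 4 powr \<nu> * (inverse (fact n) * (4 * w) ^ n)"
    by (simp add: powr_add powr_realpow power_mult_distrib field_simps)
  finally show "norm (clifford_sq_coeff \<nu> n * Gamma (2 * \<nu> + real n + 1) * w ^ n) \<le> 4 powr \<nu> * (inverse (fact n) * (4 * w) ^ n)" .
qed

section \<open>Measurability, Gamma and Beta integrals, termwise integration\<close>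

lemma isCont_clifford: "\<nu> \<ge> 0 \<Longrightarrow> isCont (clifford \<nu>) z"
  by (rule DERIV_isCont[OF DERIV_clifford])

lemma borel_measurable_clifford:
  assumes "\<nu> \<ge> 0" shows "clifford \<nu> \<in> borel_measurable borel"
  using isCont_clifford[OF assms]
  by (intro borel_measurable_continuous_onI continuous_at_imp_continuous_on) auto

lemma has_bochner_integral_Gamma:
  assumes "s > (0::real)"
  shows "has_bochner_integral lborel (\<lambda>t. indicator {0<..} t * (t powr (s - 1) * exp (- t))) (Gamma s)"
proof (rule has_bochner_integral_nn_integral)
  have "ennreal (Gamma s) = (\<integral>\<^sup>+ t. ennreal (indicator {0..} t * t powr (s - 1) / exp t) \<partial>lborel)"
    using Gamma_conv_nn_integral_real[OF assms] .
  also have "\<dots> = (\<integral>\<^sup>+ t. ennreal (indicator {0<..} t * (t powr (s - 1) * exp (- t))) \<partial>lborel)"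
    by (intro nn_integral_cong) (auto simp: indicator_def exp_minus divide_inverse)
  finally show "(\<integral>\<^sup>+ t. ennreal (indicator {0<..} t * (t powr (s - 1) * exp (- t))) \<partial>lborel) = ennreal (Gamma s)" ..
qed (use assms in \<open>auto intro: less_imp_le Gamma_real_pos\<close>)

lemma has_bochner_integral_Beta:
  assumes "a > (0::real)" "b > (0::real)"
  shows "has_bochner_integral lborel (\<lambda>t. indicator {0<..<1} t * (t powr (a - 1) * (1 - t) powr (b - 1))) (Beta a b)"
proof (rule has_bochner_integral_nn_integral)
  have "ennreal (Beta a b) = (\<integral>\<^sup>+ t. ennreal (indicator {0..1} t * (t powr (a - 1) * (1 - t) powr (b - 1))) \<partial>lborel)"
    using nn_integral_has_integral_lebesgue[OF _ has_integral_Beta_real[OF assms]] by simp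
  also have "\<dots> = (\<integral>\<^sup>+ t. ennreal (indicator {0<..<1} t * (t powr (a - 1) * (1 - t) powr (b - 1))) \<partial>lborel)"
    by (intro nn_integral_cong) (auto simp: indicator_def not_less)
  finally show "(\<integral>\<^sup>+ t. ennreal (indicator {0<..<1} t * (t powr (a - 1) * (1 - t) powr (b - 1))) \<partial>lborel) = ennreal (Beta a b)" ..
  show "0 \<le> Beta a b" using assms unfolding Beta_def
    by (intro less_imp_le divide_pos_pos mult_pos_pos Gamma_real_pos) auto
qed auto

lemma has_bochner_integral_suminf:
  fixes f :: "nat \<Rightarrow> 'a \<Rightarrow> real"
  assumes "\<And>n. integrable M (f n)" "\<And>x. summable (\<lambda>n. norm (f n x))"
    and "summable (\<lambda>n. \<integral>x. norm (f n x) \<partial>M)"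
  shows "has_bochner_integral M (\<lambda>x. \<Sum>n. f n x) (\<Sum>n. \<integral>x. f n x \<partial>M)"
  using integrable_suminf[OF assms(1) _ assms(3)] integral_suminf[OF assms(1) _ assms(3)] assms(2)
  by (auto simp: has_bochner_integral_iff)

text \<open>
  The integral of \<open>J_\<nu>(x)\<^sup>2 / x\<close> is invariant under \<open>x \<mapsto> \<lambda> x\<close>, so it may be averaged over the scales
  \<open>\<lambda>\<close>. The weight \<open>t\<^sup>\<nu> e\<^sup>-\<^sup>t\<close> with \<open>t = \<lambda>\<^sup>2\<close> is chosen so that the averaged power series becomes a Beta
  average of exponentials, after which everything is a Gamma integral.
\<close>

lemma clifford_square_average:
  assumes "\<nu> > 0" "w > 0"
  shows "has_bochner_integral lborel
    (\<lambda>t. indicator {0<..} t * (t powr (2 * \<nu>) * exp (- t) * (clifford \<nu> (- (t * w)))\<^sup>2))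
    (\<Sum>n. clifford_sq_coeff \<nu> n * Gamma (2 * \<nu> + real n + 1) * (- w) ^ n)"
proof -
  define f where "f = (\<lambda>n t. clifford_sq_coeff \<nu> n * (- w) ^ n * (indicator {0<..} t * (t powr (2 * \<nu> + real n) * exp (- t))))"
  have I: "has_bochner_integral lborel (\<lambda>t. indicator {0<..} t * (t powr (2 * \<nu> + real n) * exp (- t))) (Gamma (2 * \<nu> + real n + 1))" for n
    using has_bochner_integral_Gamma[of "2 * \<nu> + real n + 1"] assms by simp
  then have If: "has_bochner_integral lborel (f n) (clifford_sq_coeff \<nu> n * (- w) ^ n * Gamma (2 * \<nu> + real n + 1))" for n
    unfolding f_def by (intro has_bochner_integral_mult_right) auto
  have nf: "norm (f n t) = clifford_sq_coeff \<nu> n * w ^ n * (indicator {0<..} t * (t powr (2 * \<nu> + real n) * exp (- t)))" for n t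
    using assms clifford_sq_coeff_pos[of \<nu> n] by (simp add: f_def abs_mult power_abs)
  have Inf: "(\<integral>t. norm (f n t) \<partial>lborel) = clifford_sq_coeff \<nu> n * Gamma (2 * \<nu> + real n + 1) * w ^ n" for n
    unfolding nf using has_bochner_integral_integral_eq[OF I[of n]] by simp
  have tp: "t powr (2 * \<nu> + real n) = t powr (2 * \<nu>) * t ^ n" if "t > 0" for n t
    using that by (simp add: powr_add powr_realpow)
  have "has_bochner_integral lborel (\<lambda>t. \<Sum>n. f n t) (\<Sum>n. \<integral>t. f n t \<partial>lborel)"
  proof (rule has_bochner_integral_suminf)
    show "integrable lborel (f n)" for n using If by (auto simp: has_bochner_integral_iff)
    show "summable (\<lambda>n. \<integral>t. norm (f n t) \<partial>lborel)"
      unfolding Inf using assms by (intro clifford_sq_coeff_Gamma_summable) auto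
    show "summable (\<lambda>n. norm (f n t))" for t
    proof (cases "t > 0")
      case True
      have "summable (\<lambda>n. (t powr (2 * \<nu>) * exp (- t)) * (clifford_sq_coeff \<nu> n * (t * w) ^ n))"
        using sums_summable[OF clifford_square_sums[of \<nu> "t * w"]] assms by (intro summable_mult) auto
      then show ?thesis unfolding nf tp[OF True] using True by (simp add: power_mult_distrib mult_ac)
    qed (simp add: f_def)
  qed
  moreover have "(\<Sum>n. f n t) = indicator {0<..} t * (t powr (2 * \<nu>) * exp (- t) * (clifford \<nu> (- (t * w)))\<^sup>2)" for t
  proof (cases "t > 0")
    case True
    have "(\<lambda>n. (t powr (2 * \<nu>) * exp (- t)) * (clifford_sq_coeff \<nu> n * (- (t * w)) ^ n)) sums
        ((t powr (2 * \<nu>) * exp (- t)) * (clifford \<nu> (- (t * w)))\<^sup>2)"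
      using assms by (intro sums_mult clifford_square_sums) auto
    moreover have "(- (t * w)) ^ n = t ^ n * (- w) ^ n" for n by (simp flip: power_mult_distrib)
    ultimately have "(\<lambda>n. f n t) sums ((t powr (2 * \<nu>) * exp (- t)) * (clifford \<nu> (- (t * w)))\<^sup>2)"
      unfolding f_def tp[OF True] using True by (simp add: mult_ac)
    then show ?thesis using True by (simp add: sums_iff)
  qed (simp add: f_def)
  moreover have "(\<integral>t. f n t \<partial>lborel) = clifford_sq_coeff \<nu> n * Gamma (2 * \<nu> + real n + 1) * (- w) ^ n" for n
    using has_bochner_integral_integral_eq[OF If[of n]] by (simp add: mult_ac)
  ultimately show ?thesis by simp
qed

text \<open>Each Beta value is a moment of the arcsine weight, so summing under the integral
  rebuilds the power series of exp(-4wv).\<close>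

lemma clifford_average_eq_Beta_integral:
  assumes "\<nu> > 0" "w > 0"
  shows "has_bochner_integral lborel
    (\<lambda>v. indicator {0<..<1} v * (v powr (- 1 / 2) * (1 - v) powr (- 1 / 2) * ((4 * w * v) powr \<nu> * exp (- (4 * w * v)))))
    (pi * w powr \<nu> * (\<Sum>n. clifford_sq_coeff \<nu> n * Gamma (2 * \<nu> + real n + 1) * (- w) ^ n))"
proof -
  define f where "f = (\<lambda>n v. (4 * w) powr \<nu> * (- (4 * w)) ^ n / fact n *
    (indicator {0<..<1} v * (v powr (\<nu> + real n - 1 / 2) * (1 - v) powr (- 1 / 2))))"
  have I: "has_bochner_integral lborel (\<lambda>v. indicator {0<..<1} v * (v powr (\<nu> + real n - 1 / 2) * (1 - v) powr (- 1 / 2)))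
     (Beta (\<nu> + real n + 1 / 2) (1 / 2))" for n
    using has_bochner_integral_Beta[of "\<nu> + real n + 1 / 2" "1 / 2"] assms by (simp add: algebra_simps)
  then have If: "has_bochner_integral lborel (f n) ((4 * w) powr \<nu> * (- (4 * w)) ^ n / fact n * Beta (\<nu> + real n + 1 / 2) (1 / 2))" for n
    unfolding f_def by (intro has_bochner_integral_mult_right) auto
  have nf: "norm (f n v) = (4 * w) powr \<nu> * (4 * w) ^ n / fact n *
    (indicator {0<..<1} v * (v powr (\<nu> + real n - 1 / 2) * (1 - v) powr (- 1 / 2)))" for n v
    using assms by (simp add: f_def abs_mult power_abs)
  have eB: "(4 * w) powr \<nu> * (4 * w) ^ n / fact n * Beta (\<nu> + real n + 1 / 2) (1 / 2)
      = pi * w powr \<nu> * (clifford_sq_coeff \<nu> n * Gamma (2 * \<nu> + real n + 1) * w ^ n)" for n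
    using assms by (simp add: clifford_sq_coeff_eq_Beta powr_add powr_realpow powr_mult power_mult_distrib)
  have Inf: "(\<integral>v. norm (f n v) \<partial>lborel) = pi * w powr \<nu> * (clifford_sq_coeff \<nu> n * Gamma (2 * \<nu> + real n + 1) * w ^ n)" for n
    unfolding nf eB[symmetric] using has_bochner_integral_integral_eq[OF I[of n]] by simp
  have vp: "v powr (\<nu> + real n - 1 / 2) = v powr \<nu> * v ^ n * v powr (- 1 / 2)" if "v > 0" for n v
    using that powr_add[of v "\<nu> + real n" "- 1 / 2"] by (simp add: powr_add powr_realpow)
  have "has_bochner_integral lborel (\<lambda>v. \<Sum>n. f n v) (\<Sum>n. \<integral>v. f n v \<partial>lborel)"
  proof (rule has_bochner_integral_suminf)
    show "integrable lborel (f n)" for n using If by (auto simp: has_bochner_integral_iff)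
    show "summable (\<lambda>n. \<integral>v. norm (f n v) \<partial>lborel)"
      unfolding Inf using assms by (intro summable_mult clifford_sq_coeff_Gamma_summable) auto
    show "summable (\<lambda>n. norm (f n v))" for v
    proof (cases "v > 0")
      case True
      define C where "C = (4 * w) powr \<nu> * (indicator {0<..<1} v * (v powr \<nu> * v powr (- 1 / 2) * (1 - v) powr (- 1 / 2)))"
      have "norm (f n v) = C * (inverse (fact n) * (4 * w * v) ^ n)" for n
        unfolding nf vp[OF True] C_def power_mult_distrib[of "4 * w" v] by (simp only: divide_inverse mult_ac)
      moreover have "summable (\<lambda>n. C * (inverse (fact n) * (4 * w * v) ^ n))"
        by (intro summable_mult summable_exp)
      ultimately show ?thesis by (simp only:)
    qed (simp add: f_def)
  qed
  moreover have "(\<Sum>n. f n v) = indicator {0<..<1} v * (v powr (- 1 / 2) * (1 - v) powr (- 1 / 2) * ((4 * w * v) powr \<nu> * exp (- (4 * w * v))))" for v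
  proof (cases "v > 0")
    case True
    define C where "C = indicator {0<..<1} v * (v powr (- 1 / 2) * (1 - v) powr (- 1 / 2) * (4 * w * v) powr \<nu>)"
    have p: "(4 * w * v) powr \<nu> = (4 * w) powr \<nu> * v powr \<nu>" using assms True by (simp add: powr_mult)
    have "f n v = C * ((- (4 * w * v)) ^ n /\<^sub>R fact n)" for n
    proof -
      have "(- (4 * w * v)) ^ n = (- (4 * w)) ^ n * v ^ n" by (simp only: minus_mult_left power_mult_distrib)
      then show ?thesis unfolding f_def vp[OF True] C_def p by (simp only: divide_inverse real_scaleR_def mult_ac)
    qed
    then have "(\<lambda>n. f n v) sums (C * exp (- (4 * w * v)))"
      by (simp only:) (intro sums_mult exp_converges)
    then show ?thesis by (simp only: sums_iff C_def mult.assoc)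
  qed (simp add: f_def)
  moreover have "(\<integral>v. f n v \<partial>lborel) = pi * w powr \<nu> * (clifford_sq_coeff \<nu> n * Gamma (2 * \<nu> + real n + 1) * (- w) ^ n)" for n
  proof -
    have m: "(- (4 * w)) ^ n = (-1) ^ n * (4 * w) ^ n" "(- w) ^ n = (-1) ^ n * w ^ n"
      by (rule power_minus)+
    have "pi * w powr \<nu> * (clifford_sq_coeff \<nu> n * Gamma (2 * \<nu> + real n + 1) * (- w) ^ n)
       = (-1) ^ n * (pi * w powr \<nu> * (clifford_sq_coeff \<nu> n * Gamma (2 * \<nu> + real n + 1) * w ^ n))"
      unfolding m by (simp only: mult_ac)
    also have "\<dots> = (4 * w) powr \<nu> * (- (4 * w)) ^ n / fact n * Beta (\<nu> + real n + 1 / 2) (1 / 2)"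
      unfolding eB[of n, symmetric] m by (simp only: divide_inverse mult_ac)
    finally have "pi * w powr \<nu> * (clifford_sq_coeff \<nu> n * Gamma (2 * \<nu> + real n + 1) * (- w) ^ n)
       = (4 * w) powr \<nu> * (- (4 * w)) ^ n / fact n * Beta (\<nu> + real n + 1 / 2) (1 / 2)" .
    then show ?thesis using has_bochner_integral_integral_eq[OF If[of n]] by simp
  qed
  \<comment> \<open>Convergence allows the factor pi w^\<nu> to be moved out of the infinite
    sum.\<close>
  moreover have "summable (\<lambda>n. clifford_sq_coeff \<nu> n * Gamma (2 * \<nu> + real n + 1) * (- w) ^ n)"
  proof (rule summable_norm_cancel)
    have "norm (clifford_sq_coeff \<nu> n * Gamma (2 * \<nu> + real n + 1) * (- w) ^ n) = clifford_sq_coeff \<nu> n * Gamma (2 * \<nu> + real n + 1) * w ^ n" for n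
      using assms clifford_sq_coeff_pos[of \<nu> n] Gamma_real_pos[of "2 * \<nu> + real n + 1"] by (simp add: abs_mult power_abs)
    then show "summable (\<lambda>n. norm (clifford_sq_coeff \<nu> n * Gamma (2 * \<nu> + real n + 1) * (- w) ^ n))"
      using clifford_sq_coeff_Gamma_summable[of \<nu> w] assms by simp
  qed
  ultimately show ?thesis by (simp add: suminf_mult)
qed

text \<open>Call the integral I. The double integral of \<open>K\<close> is evaluated in two orders:
  integrating over w first, a dilation gives Gamma(\<nu>+1) I; integrating over t first, the Beta
  average of exponentials gives Gamma(\<nu>). Hence I = 1/\<nu>. With nonnegative integrals
  throughout, finiteness of I is part of the conclusion.\<close>

lemma nn_integral_clifford_square:
  assumes "\<nu> > 0"
  shows "(\<integral>\<^sup>+ w. ennreal (indicator {0<..} w * (w powr (\<nu> - 1) * (clifford \<nu> (- w))\<^sup>2)) \<partial>lborel) = ennreal (1 / \<nu>)"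
proof -
  have [measurable]: "clifford \<nu> \<in> borel_measurable borel"
    using assms by (intro borel_measurable_clifford) auto
  define F where "F = (\<lambda>w. ennreal (indicator {0<..} w * (w powr (\<nu> - 1) * (clifford \<nu> (- w))\<^sup>2)))"
  define G where "G = (\<lambda>t. ennreal (indicator {0<..} t * (t powr \<nu> * exp (- t))))"
  define S where "S = (\<lambda>w. \<Sum>n. clifford_sq_coeff \<nu> n * Gamma (2 * \<nu> + real n + 1) * (- w) ^ n)"
  define K where "K = (\<lambda>t w. ennreal (indicator {0<..} t * indicator {0<..} w * (w powr (\<nu> - 1) * (t powr (2 * \<nu>) * exp (- t) * (clifford \<nu> (- (t * w)))\<^sup>2))))"
  define L where "L = (\<lambda>v w. ennreal (indicator {0<..<1} v * indicator {0<..} w * (v powr (- 1 / 2) * (1 - v) powr (- 1 / 2) * ((4 * w * v) powr \<nu> * exp (- (4 * w * v)) / w))))"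
  have [measurable]: "F \<in> borel_measurable borel" "G \<in> borel_measurable borel"
    unfolding F_def G_def by measurable
  have Gi: "(\<integral>\<^sup>+ t. G t \<partial>lborel) = ennreal (Gamma (\<nu> + 1))"
    using nn_integral_eq_integral[of lborel "\<lambda>t. indicator {0<..} t * (t powr \<nu> * exp (- t))"]
      has_bochner_integral_Gamma[of "\<nu> + 1"] assms by (simp add: G_def has_bochner_integral_iff)
  \<comment> \<open>K t w = G t * t * F (t w), and the substitution t w absorbs the factor
    t.\<close>
  have K1: "(\<integral>\<^sup>+ w. K t w \<partial>lborel) = G t * (\<integral>\<^sup>+ w. F w \<partial>lborel)" for t
  proof (cases "t > 0")
    case True
    have tp: "t powr (2 * \<nu>) = t powr \<nu> * (t * t powr (\<nu> - 1))"
      using True powr_add[of t \<nu> \<nu>] by (simp add: powr_diff)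
    have "K t w = G t * (ennreal t * F (0 + t * w))" for w
    proof (cases "w > 0")
      case w: True
      then show ?thesis unfolding K_def G_def F_def tp using True
        by (simp add: powr_mult mult_ac flip: ennreal_mult)
    qed (use True in \<open>simp add: K_def F_def zero_less_mult_iff\<close>)
    then have "(\<integral>\<^sup>+ w. K t w \<partial>lborel) = G t * (ennreal t * (\<integral>\<^sup>+ w. F (0 + t * w) \<partial>lborel))"
      by (simp add: nn_integral_cmult)
    also have "ennreal t * (\<integral>\<^sup>+ w. F (0 + t * w) \<partial>lborel) = (\<integral>\<^sup>+ w. F w \<partial>lborel)"
      using nn_integral_real_affine[of F t 0] True by simp
    finally show ?thesis .
  qed (simp add: K_def G_def)
  have Km: "case_prod K \<in> borel_measurable (lborel \<Otimes>\<^sub>M lborel)"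
    unfolding K_def by measurable
  have Lm: "case_prod L \<in> borel_measurable (lborel \<Otimes>\<^sub>M lborel)"
    unfolding L_def by measurable
  have Lm': "case_prod (\<lambda>w v. L v w) \<in> borel_measurable (lborel \<Otimes>\<^sub>M lborel)"
    unfolding L_def by measurable
  have KL: "(\<integral>\<^sup>+ t. K t w \<partial>lborel) = ennreal (1 / pi) * (\<integral>\<^sup>+ v. L v w \<partial>lborel)" for w
  proof (cases "w > 0")
    case True
    have a: "(\<integral>\<^sup>+ t. ennreal (indicator {0<..} t * (t powr (2 * \<nu>) * exp (- t) * (clifford \<nu> (- (t * w)))\<^sup>2)) \<partial>lborel) = ennreal (S w)"
      using clifford_square_average[OF assms True] nn_integral_eq_integral[of lborel "\<lambda>t. indicator {0<..} t * (t powr (2 * \<nu>) * exp (- t) * (clifford \<nu> (- (t * w)))\<^sup>2)"]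
      by (simp add: has_bochner_integral_iff S_def)
    have b: "(\<integral>\<^sup>+ v. ennreal (indicator {0<..<1} v * (v powr (- 1 / 2) * (1 - v) powr (- 1 / 2) * ((4 * w * v) powr \<nu> * exp (- (4 * w * v))))) \<partial>lborel)
       = ennreal (pi * w powr \<nu> * S w)"
      using clifford_average_eq_Beta_integral[OF assms True]
        nn_integral_eq_integral[of lborel "\<lambda>v. indicator {0<..<1} v * (v powr (- 1 / 2) * (1 - v) powr (- 1 / 2) * ((4 * w * v) powr \<nu> * exp (- (4 * w * v))))"]
      by (simp add: has_bochner_integral_iff S_def)
    have "K t w = ennreal (w powr (\<nu> - 1)) * ennreal (indicator {0<..} t * (t powr (2 * \<nu>) * exp (- t) * (clifford \<nu> (- (t * w)))\<^sup>2))" for t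
      using True by (simp add: K_def mult_ac flip: ennreal_mult)
    then have "(\<integral>\<^sup>+ t. K t w \<partial>lborel) = ennreal (w powr (\<nu> - 1)) * ennreal (S w)"
      by (subst a[symmetric], subst nn_integral_cmult[symmetric]) auto
    also have "\<dots> = ennreal (1 / pi) * (ennreal (1 / w) * ennreal (pi * w powr \<nu> * S w))"
      using True by (simp add: powr_diff flip: ennreal_mult')
    also have "ennreal (1 / w) * ennreal (pi * w powr \<nu> * S w) = (\<integral>\<^sup>+ v. L v w \<partial>lborel)"
    proof -
      have "L v w = ennreal (1 / w) * ennreal (indicator {0<..<1} v * (v powr (- 1 / 2) * (1 - v) powr (- 1 / 2) * ((4 * w * v) powr \<nu> * exp (- (4 * w * v)))))" for v
        using True by (simp add: L_def flip: ennreal_mult')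
      then show ?thesis by (subst b[symmetric], subst nn_integral_cmult[symmetric]) auto
    qed
    finally show ?thesis .
  qed (simp add: K_def L_def)
  \<comment> \<open>Since dw / w is dilation invariant, the substitution 4 v w leaves Gamma(\<nu>)
    times a weight in v alone.\<close>
  have L1: "(\<integral>\<^sup>+ w. L v w \<partial>lborel) = ennreal (Gamma \<nu>) * ennreal (indicator {0<..<1} v * (v powr (- 1 / 2) * (1 - v) powr (- 1 / 2)))" for v
  proof (cases "0 < v \<and> v < 1")
    case True
    define c where "c = 4 * v"
    define H where "H = (\<lambda>t. ennreal (indicator {0<..} t * (t powr (\<nu> - 1) * exp (- t))))"
    have [measurable]: "H \<in> borel_measurable borel" unfolding H_def by measurable
    have Hi: "(\<integral>\<^sup>+ t. H t \<partial>lborel) = ennreal (Gamma \<nu>)"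
      using nn_integral_eq_integral[of lborel "\<lambda>t. indicator {0<..} t * (t powr (\<nu> - 1) * exp (- t))"]
        has_bochner_integral_Gamma[of "\<nu>"] assms by (simp add: H_def has_bochner_integral_iff)
    have "c > 0" using True by (simp add: c_def)
    have "L v w = ennreal (v powr (- 1 / 2) * (1 - v) powr (- 1 / 2)) * (ennreal c * H (0 + c * w))" for w
    proof (cases "w > 0")
      case w: True
      have wv: "4 * w * v = c * w" by (simp add: c_def)
      show ?thesis unfolding L_def H_def wv using True w \<open>c > 0\<close>
        by (simp add: powr_diff flip: ennreal_mult')
    qed (use \<open>c > 0\<close> in \<open>simp add: L_def H_def zero_less_mult_iff\<close>)
    then have "(\<integral>\<^sup>+ w. L v w \<partial>lborel) = ennreal (v powr (- 1 / 2) * (1 - v) powr (- 1 / 2)) * (ennreal c * (\<integral>\<^sup>+ w. H (0 + c * w) \<partial>lborel))"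
      by (simp add: nn_integral_cmult)
    also have "ennreal c * (\<integral>\<^sup>+ w. H (0 + c * w) \<partial>lborel) = ennreal (Gamma \<nu>)"
      using nn_integral_real_affine[of H c 0] \<open>c > 0\<close> Hi by simp
    finally show ?thesis using True by (simp add: mult.commute)
  qed (auto simp: L_def)
  \<comment> \<open>The mass pi of the arcsine weight cancels the factor 1/pi in
    \<open>KL\<close>.\<close>
  have Bi: "(\<integral>\<^sup>+ v. ennreal (indicator {0<..<1} v * (v powr (- 1 / 2) * (1 - v) powr (- 1 / 2))) \<partial>lborel) = ennreal pi"
    using nn_integral_eq_integral[of lborel "\<lambda>v. indicator {0<..<1} v * (v powr (- 1 / 2) * (1 - v) powr (- 1 / 2))"]
      has_bochner_integral_Beta[of "1 / 2" "1 / 2"] by (simp add: has_bochner_integral_iff Beta_def Gamma_one_half_real)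
  have "ennreal (Gamma (\<nu> + 1)) * (\<integral>\<^sup>+ w. F w \<partial>lborel) = (\<integral>\<^sup>+ t. \<integral>\<^sup>+ w. K t w \<partial>lborel \<partial>lborel)"
    unfolding K1 by (simp add: nn_integral_multc Gi)
  also have "\<dots> = (\<integral>\<^sup>+ w. \<integral>\<^sup>+ t. K t w \<partial>lborel \<partial>lborel)"
    using lborel_pair.Fubini'[OF Km] by simp
  also have "\<dots> = ennreal (1 / pi) * (\<integral>\<^sup>+ w. \<integral>\<^sup>+ v. L v w \<partial>lborel \<partial>lborel)"
    unfolding KL by (intro nn_integral_cmult lborel.borel_measurable_nn_integral Lm')
  also have "(\<integral>\<^sup>+ w. \<integral>\<^sup>+ v. L v w \<partial>lborel \<partial>lborel) = (\<integral>\<^sup>+ v. \<integral>\<^sup>+ w. L v w \<partial>lborel \<partial>lborel)"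
    using lborel_pair.Fubini'[OF Lm] by simp
  also have "\<dots> = ennreal (Gamma \<nu>) * ennreal pi"
    unfolding L1 using Bi by (subst nn_integral_cmult) auto
  also have "ennreal (1 / pi) * (ennreal (Gamma \<nu>) * ennreal pi) = ennreal (Gamma \<nu>)"
    using assms by (simp add: Gamma_real_pos less_imp_le flip: ennreal_mult')
  also have "\<dots> = ennreal (Gamma (\<nu> + 1)) * ennreal (1 / \<nu>)"
  proof -
    have "\<nu> \<notin> \<int>\<^sub>\<le>\<^sub>0" using assms by (auto elim!: nonpos_Ints_cases')
    then show ?thesis using assms Gamma_plus1[of \<nu>] by (simp flip: ennreal_mult')
  qed
  finally have "ennreal (Gamma (\<nu> + 1)) * (\<integral>\<^sup>+ w. F w \<partial>lborel) = ennreal (Gamma (\<nu> + 1)) * ennreal (1 / \<nu>)" .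
  moreover have "Gamma (\<nu> + 1) > 0" using assms by (intro Gamma_real_pos) auto
  ultimately show ?thesis unfolding F_def by (subst (asm) ennreal_mult_cancel_left) auto
qed

text \<open>Substitution w = x^2/4 in the preceding integral. Jacobian times integrand is 2
  J_\<nu>(x)^2 / x, hence half of 1/\<nu>.\<close>

lemma bessel_J_square_integral:
  assumes "\<nu> > 0"
  shows "has_bochner_integral lborel (\<lambda>x. indicator {0<..} x * ((bessel_J \<nu> x)\<^sup>2 / x)) (1 / (2 * \<nu>))"
proof -
  have [measurable]: "clifford \<nu> \<in> borel_measurable borel"
    using assms by (intro borel_measurable_clifford) auto
  define f where "f = (\<lambda>w. w powr (\<nu> - 1) * (clifford \<nu> (- w))\<^sup>2)"
  have mf: "(\<lambda>w. indicator {0<..} w * f w) \<in> borel_measurable lborel"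
    unfolding f_def by measurable
  have "has_bochner_integral lborel (\<lambda>w. indicator {0<..} w * f w) (1 / \<nu>)"
    using nn_integral_clifford_square[OF assms] mf assms
    by (intro has_bochner_integral_nn_integral) (auto simp: f_def)
  then have 1: "set_integrable lborel {0<..} f \<and> (LBINT w:{0<..}. f w) = 1 / \<nu>"
    unfolding set_integrable_def set_lebesgue_integral_def by (auto simp: has_bochner_integral_iff)
  have im: "(\<lambda>x. x\<^sup>2 / 4) ` {0<..} = {0::real<..}"
  proof -
    have "w \<in> (\<lambda>x. x\<^sup>2 / 4) ` {0<..}" if "w > 0" for w :: real
      using that by (intro image_eqI[of _ _ "2 * sqrt w"]) (auto simp: power_mult_distrib)
    then show ?thesis by auto
  qed
  have inj: "inj_on (\<lambda>x. x\<^sup>2 / 4) {0::real<..}"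
    by (auto simp: inj_on_def power2_eq_iff)
  have eq: "\<bar>x / 2\<bar> * f (x\<^sup>2 / 4) = 2 * ((bessel_J \<nu> x)\<^sup>2 / x)" if "x \<in> {0<..}" for x
  proof -
    have "(x\<^sup>2 / 4) powr (\<nu> - 1) = ((x / 2) powr \<nu>)\<^sup>2 / (x\<^sup>2 / 4)"
      using that by (simp add: powr_diff power_divide power2_eq_square flip: powr_mult)
    then show ?thesis using that assms
      by (simp add: f_def bessel_J_clifford power_mult_distrib power2_eq_square)
  qed
  have "f absolutely_integrable_on {0<..} \<and> integral {0<..} f = 1 / \<nu>"
  proof -
    have "set_integrable lebesgue {0<..} f \<and> (LINT w:{0<..}|lebesgue. f w) = 1 / \<nu>"
      using 1 mf unfolding set_integrable_def set_lebesgue_integral_def by (auto simp: integrable_completion integral_completion)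
    then show ?thesis using set_lebesgue_integral_eq_integral(2)[of "{0<..}" f] by auto
  qed
  then have "(\<lambda>x. \<bar>x / 2\<bar> * f (x\<^sup>2 / 4)) absolutely_integrable_on {0<..} \<and>
      integral {0<..} (\<lambda>x. \<bar>x / 2\<bar> * f (x\<^sup>2 / 4)) = 1 / \<nu>"
  proof (subst has_absolute_integral_change_of_variables_1'[where g = "\<lambda>x. x\<^sup>2 / 4"])
    show "((\<lambda>x. x\<^sup>2 / 4) has_field_derivative x / 2) (at x within {0<..})" for x :: real
      by (auto intro!: derivative_eq_intros)
  qed (use im inj in auto)
  then have 2: "set_integrable lebesgue {0<..} (\<lambda>x. \<bar>x / 2\<bar> * f (x\<^sup>2 / 4)) \<and>
      (LINT x:{0<..}|lebesgue. \<bar>x / 2\<bar> * f (x\<^sup>2 / 4)) = 1 / \<nu>"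
    using set_lebesgue_integral_eq_integral(2) by metis
  have i: "indicator {0<..} x *\<^sub>R (\<bar>x / 2\<bar> * f (x\<^sup>2 / 4)) = 2 * (indicator {0<..} x * ((bessel_J \<nu> x)\<^sup>2 / x))" for x
    using eq[of x] by (cases "x > 0") auto
  have "(\<lambda>x. indicator {0<..} x *\<^sub>R (\<bar>x / 2\<bar> * f (x\<^sup>2 / 4))) \<in> borel_measurable lborel"
    unfolding f_def by measurable
  then have "has_bochner_integral lborel (\<lambda>x. 2 * (indicator {0<..} x * ((bessel_J \<nu> x)\<^sup>2 / x))) (1 / \<nu>)"
    using 2 unfolding set_integrable_def set_lebesgue_integral_def i 
    by (auto simp: has_bochner_integral_iff integrable_completion integral_completion)
  from has_bochner_integral_mult_right[of "1 / 2", OF this] show ?thesis by simp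
qed

section \<open>Orthogonality\<close>

lemma tendsto_bessel_J_at_top:
  assumes "\<nu> \<ge> 0"
  shows "(bessel_J \<nu> \<longlongrightarrow> 0) at_top"
proof (rule Lim_null_comparison)
  show "\<forall>\<^sub>F x in at_top. norm (bessel_J \<nu> x) \<le> exp (3 * \<nu> + 4) * x powr (- 1 / 2)"
    using eventually_gt_at_top[of "0::real"]
  proof eventually_elim
    case (elim x)
    show ?case using bessel_J_decay[OF assms elim] by simp
  qed
  show "((\<lambda>x. exp (3 * \<nu> + 4) * x powr (- 1 / 2)) \<longlongrightarrow> 0) at_top"
  proof -
    have "((\<lambda>x::real. x powr (- 1 / 2)) \<longlongrightarrow> 0) at_top"
      by (rule tendsto_neg_powr[OF _ filterlim_ident]) simp
    from tendsto_mult[OF tendsto_const this] show ?thesis by simp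
  qed
qed

lemma tendsto_bessel_J_at_right_0:
  assumes "\<nu> > 0"
  shows "(bessel_J \<nu> \<longlongrightarrow> 0) (at_right 0)"
proof (rule Lim_transform_eventually)
  have "((\<lambda>x::real. - (x\<^sup>2 / 4)) \<longlongrightarrow> - (0\<^sup>2 / 4)) (at_right 0)"
    by (intro tendsto_intros) auto
  with assms have "((\<lambda>x. clifford \<nu> (- (x\<^sup>2 / 4))) \<longlongrightarrow> clifford \<nu> (- (0\<^sup>2 / 4))) (at_right 0)"
    by (intro isCont_tendsto_compose[OF isCont_clifford]) auto
  moreover have "((\<lambda>x. (x / 2) powr \<nu>) \<longlongrightarrow> 0) (at_right 0)"
  proof (rule tendsto_zero_powrI)
    show "((\<lambda>x::real. x / 2) \<longlongrightarrow> 0) (at_right 0)"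
      using tendsto_divide[OF tendsto_ident_at tendsto_const, of 2 0 "{0::real<..}"] by simp
    show "\<forall>\<^sub>F x in at_right 0. 0 \<le> x / (2::real)"
      using eventually_at_right_less[of "0::real"] by eventually_elim simp
  qed (use assms in auto)
  ultimately show "((\<lambda>x. (x / 2) powr \<nu> * clifford \<nu> (- (x\<^sup>2 / 4))) \<longlongrightarrow> 0) (at_right 0)"
    using tendsto_mult[of "\<lambda>x. (x / 2) powr \<nu>" 0 "at_right 0"] by fastforce
  show "\<forall>\<^sub>F x in at_right 0. (x / 2) powr \<nu> * clifford \<nu> (- (x\<^sup>2 / 4)) = bessel_J \<nu> x"
    using eventually_at_right_less[of "0::real"]
  proof eventually_elim
    case (elim x)
    show ?case using assms elim by (intro bessel_J_clifford[symmetric]) auto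
  qed
qed

text \<open>Stands in for the asymptotics at infinity: J_{\<nu>+2m} and (-1)^m J_\<nu> agree up to
  o(1/x). In the recurrence multiplied by x, the right side is a constant times a Bessel function
  and tends to 0, so each step of two in the order only flips the sign.\<close>

lemma tendsto_bessel_J_shift:
  assumes "\<nu> \<ge> 0"
  shows "((\<lambda>x. x * (bessel_J (\<nu> + 2 * real m) x - (-1) ^ m * bessel_J \<nu> x)) \<longlongrightarrow> 0) at_top"
proof (induction m)
  case (Suc m)
  have "((\<lambda>x. 2 * (\<nu> + 2 * real m + 1) * bessel_J (\<nu> + 2 * real m + 1) x
      - x * (bessel_J (\<nu> + 2 * real m) x - (-1) ^ m * bessel_J \<nu> x)) \<longlongrightarrow> 2 * (\<nu> + 2 * real m + 1) * 0 - 0) at_top"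
    using assms by (intro tendsto_diff tendsto_mult_left tendsto_bessel_J_at_top Suc) auto
  moreover have "\<forall>\<^sub>F x in at_top. 2 * (\<nu> + 2 * real m + 1) * bessel_J (\<nu> + 2 * real m + 1) x
      - x * (bessel_J (\<nu> + 2 * real m) x - (-1) ^ m * bessel_J \<nu> x)
      = x * (bessel_J (\<nu> + 2 * real (Suc m)) x - (-1) ^ Suc m * bessel_J \<nu> x)"
    using eventually_gt_at_top[of "0::real"]
  proof eventually_elim
    case (elim x)
    have "bessel_J (\<nu> + 2 * real m) x + bessel_J (\<nu> + 2 * real m + 2) x
      = 2 * (\<nu> + 2 * real m + 1) / x * bessel_J (\<nu> + 2 * real m + 1) x"
      using assms elim by (intro bessel_J_rec) auto
    moreover have "\<nu> + 2 * real (Suc m) = \<nu> + 2 * real m + 2" by simp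
    ultimately have "2 * (\<nu> + 2 * real m + 1) * bessel_J (\<nu> + 2 * real m + 1) x
       = x * (bessel_J (\<nu> + 2 * real m) x + bessel_J (\<nu> + 2 * real (Suc m)) x)"
      using elim by (simp only:) simp
    then show ?case by (simp add: algebra_simps)
  qed
  ultimately show ?case by (auto elim: Lim_transform_eventually)
qed auto

lemma isCont_bessel_J: "\<nu> \<ge> 0 \<Longrightarrow> x > 0 \<Longrightarrow> isCont (bessel_J \<nu>) x"
  by (rule DERIV_isCont[OF DERIV_bessel_J])

lemma borel_measurable_bessel_J:
  assumes "\<nu> \<ge> 0"
  shows "(\<lambda>x. indicator {0<..} x * bessel_J \<nu> x) \<in> borel_measurable borel"
  using borel_measurable_continuous_on_indicator[of "{0<..}" "bessel_J \<nu>"] isCont_bessel_J[OF assms]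
  by (auto intro!: continuous_at_imp_continuous_on)

text \<open>The product is dominated by the sum of the squares, whose integrals are already known;
  this settles both ends of the half-line at once.\<close>

lemma bessel_J_product_integrable:
  assumes "\<mu> > 0" "\<nu> > 0"
  shows "set_integrable lborel {0<..} (\<lambda>x. bessel_J \<mu> x * bessel_J \<nu> x / x)"
  unfolding set_integrable_def
proof (rule Bochner_Integration.integrable_bound)
  show "integrable lborel (\<lambda>x. indicator {0<..} x * ((bessel_J \<mu> x)\<^sup>2 / x) + indicator {0<..} x * ((bessel_J \<nu> x)\<^sup>2 / x))"
    using bessel_J_square_integral assms by (intro Bochner_Integration.integrable_add) (auto simp: has_bochner_integral_iff)
  have "(\<lambda>x. (indicator {0<..} x * bessel_J \<mu> x) * (indicator {0<..} x * bessel_J \<nu> x) / x) \<in> borel_measurable borel"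
    using assms by (intro borel_measurable_divide borel_measurable_times borel_measurable_bessel_J) auto
  also have "(\<lambda>x. (indicator {0<..} x * bessel_J \<mu> x) * (indicator {0<..} x * bessel_J \<nu> x) / x)
     = (\<lambda>x. indicator {0<..} x *\<^sub>R (bessel_J \<mu> x * bessel_J \<nu> x / x))"
    by (auto simp: indicator_def)
  finally show "(\<lambda>x. indicator {0<..} x *\<^sub>R (bessel_J \<mu> x * bessel_J \<nu> x / x)) \<in> borel_measurable lborel" by simp
  have ab: "\<bar>a * b\<bar> \<le> a\<^sup>2 + b\<^sup>2" for a b :: real
  proof -
    have "2 * \<bar>a * b\<bar> \<le> a\<^sup>2 + b\<^sup>2"
      using sum_squares_bound[of "\<bar>a\<bar>" "\<bar>b\<bar>"] by (simp add: abs_mult)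
    then show ?thesis using abs_ge_zero[of "a * b"] by linarith
  qed
  show "AE x in lborel. norm (indicator {0<..} x *\<^sub>R (bessel_J \<mu> x * bessel_J \<nu> x / x))
     \<le> norm (indicator {0<..} x * ((bessel_J \<mu> x)\<^sup>2 / x) + indicator {0<..} x * ((bessel_J \<nu> x)\<^sup>2 / x))"
    using ab by (intro AE_I2) (auto simp: indicator_def divide_right_mono simp flip: add_divide_distrib)
qed

lemma bessel_J_orthogonal:
  assumes "\<nu> > 0" "m > 0"
  shows "(LBINT x:{0<..}. bessel_J (\<nu> + 2 * real m) x * bessel_J \<nu> x / x) = 0"
proof -
  define \<mu> where "\<mu> = \<nu> + 2 * real m"
  have \<mu>: "\<mu> > 0" "\<mu> \<noteq> \<nu>" using assms by (auto simp: \<mu>_def)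
  \<comment> \<open>This is x (J_\<mu> J_\<nu>' - J_\<mu>' J_\<nu>), the Wronskian for which
    Bessel's equation gives w' = (\<nu>^2 - \<mu>^2) J_\<mu> J_\<nu> / x. The derivatives are
    eliminated so that both limits can be read off from values of Bessel functions.\<close>
  define w where "w = (\<lambda>x. (\<nu> - \<mu>) * (bessel_J \<mu> x * bessel_J \<nu> x)
    + x * (bessel_J (\<mu> + 1) x * bessel_J \<nu> x - bessel_J \<mu> x * bessel_J (\<nu> + 1) x))"
  have dw: "(w has_field_derivative (\<nu>\<^sup>2 - \<mu>\<^sup>2) * (bessel_J \<mu> x * bessel_J \<nu> x / x)) (at x)" if x: "x > 0" for x
  proof -
    \<comment> \<open>With 1/x as a variable \<open>p\<close> subject to x p = 1, the derivative
      identity is polynomial.\<close>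
    define p a b c d where "p = 1 / x" and "a = bessel_J \<mu> x" and "b = bessel_J (\<mu> + 1) x"
      and "c = bessel_J \<nu> x" and "d = bessel_J (\<nu> + 1) x"
    note abcd = a_def[symmetric] b_def[symmetric] c_def[symmetric] d_def[symmetric]
    have D: "(bessel_J \<mu> has_field_derivative \<mu> * p * a - b) (at x)"
      "(bessel_J \<nu> has_field_derivative \<nu> * p * c - d) (at x)"
      "(bessel_J (\<mu> + 1) has_field_derivative a - (\<mu> + 1) * p * b) (at x)"
      "(bessel_J (\<nu> + 1) has_field_derivative c - (\<nu> + 1) * p * d) (at x)"
      using DERIV_bessel_J[of \<mu> x] DERIV_bessel_J[of \<nu> x] DERIV_bessel_J_Suc[of \<mu> x] DERIV_bessel_J_Suc[of \<nu> x] assms \<mu> x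
      unfolding abcd by (simp_all add: p_def)
    have xp: "x * p = 1" using x by (simp add: p_def)
    have "(w has_field_derivative (\<nu> - \<mu>) * ((\<mu> * p * a - b) * c + (\<nu> * p * c - d) * a)
       + (1 * (b * c - a * d) + (((a - (\<mu> + 1) * p * b) * c + (\<nu> * p * c - d) * b)
           - ((\<mu> * p * a - b) * d + (c - (\<nu> + 1) * p * d) * a)) * x)) (at x)"
      unfolding w_def a_def b_def c_def d_def
      by (intro DERIV_add DERIV_cmult DERIV_mult DERIV_diff DERIV_ident D[unfolded a_def b_def c_def d_def])
    moreover have "(\<nu> - \<mu>) * ((\<mu> * p * a - b) * c + (\<nu> * p * c - d) * a)
       + (1 * (b * c - a * d) + (((a - (\<mu> + 1) * p * b) * c + (\<nu> * p * c - d) * b)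
           - ((\<mu> * p * a - b) * d + (c - (\<nu> + 1) * p * d) * a)) * x) = (\<nu>\<^sup>2 - \<mu>\<^sup>2) * (a * c * p)"
      using xp by algebra
    ultimately show ?thesis by (simp add: a_def c_def p_def)
  qed
  have w0: "(w \<longlongrightarrow> 0) (at_right 0)"
  proof -
    have "(w \<longlongrightarrow> (\<nu> - \<mu>) * (0 * 0) + 0 * (0 * 0 - 0 * 0)) (at_right 0)"
      unfolding w_def using assms \<mu> by (intro tendsto_intros tendsto_bessel_J_at_right_0) auto
    then show ?thesis by simp
  qed
  have wi: "(w \<longlongrightarrow> 0) at_top"
  proof -
    let ?d = "\<lambda>\<nu> x. x * (bessel_J (\<nu> + 2 * real m) x - (-1) ^ m * bessel_J \<nu> x)"
    \<comment> \<open>The products x J J need not vanish separately at infinity. Subtracting (-1)^m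
      times the lower order in both changes nothing, since the subtracted terms cancel, and each
      difference then tends to 0 even after multiplication by x.\<close>
    have "w = (\<lambda>x. (\<nu> - \<mu>) * (bessel_J \<mu> x * bessel_J \<nu> x)
       + (?d (\<nu> + 1) x * bessel_J \<nu> x - ?d \<nu> x * bessel_J (\<nu> + 1) x))"
    proof
      fix x
      have "\<nu> + 1 + 2 * real m = \<mu> + 1" by (simp add: \<mu>_def)
      then show "w x = (\<nu> - \<mu>) * (bessel_J \<mu> x * bessel_J \<nu> x)
       + (?d (\<nu> + 1) x * bessel_J \<nu> x - ?d \<nu> x * bessel_J (\<nu> + 1) x)"
        unfolding w_def by (simp only: \<mu>_def[symmetric]) (simp add: algebra_simps)
    qed
    moreover have "((\<lambda>x. (\<nu> - \<mu>) * (bessel_J \<mu> x * bessel_J \<nu> x)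
       + (?d (\<nu> + 1) x * bessel_J \<nu> x - ?d \<nu> x * bessel_J (\<nu> + 1) x)) \<longlongrightarrow>
         (\<nu> - \<mu>) * (0 * 0) + (0 * 0 - 0 * 0)) at_top"
      using assms \<mu> by (intro tendsto_intros tendsto_bessel_J_at_top tendsto_bessel_J_shift) auto
    ultimately show ?thesis by simp
  qed
  have int: "set_integrable lborel {0<..} (\<lambda>x. (\<nu>\<^sup>2 - \<mu>\<^sup>2) * (bessel_J \<mu> x * bessel_J \<nu> x / x))"
    by (rule set_integrable_mult_right) (use bessel_J_product_integrable assms \<mu> in auto)
  have "(LBINT x=0..\<infinity>. (\<nu>\<^sup>2 - \<mu>\<^sup>2) * (bessel_J \<mu> x * bessel_J \<nu> x / x)) = 0 - 0"
  proof (rule interval_integral_FTC_integrable)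
    show "(w has_vector_derivative (\<nu>\<^sup>2 - \<mu>\<^sup>2) * (bessel_J \<mu> x * bessel_J \<nu> x / x)) (at x)"
      if "0 < ereal x" for x using dw[of x] that by (simp add: has_real_derivative_iff_has_vector_derivative)
    show "isCont (\<lambda>x. (\<nu>\<^sup>2 - \<mu>\<^sup>2) * (bessel_J \<mu> x * bessel_J \<nu> x / x)) x" if "0 < ereal x" for x
      using that assms \<mu> by (intro continuous_intros isCont_bessel_J) auto
    show "set_integrable lborel (einterval 0 \<infinity>) (\<lambda>x. (\<nu>\<^sup>2 - \<mu>\<^sup>2) * (bessel_J \<mu> x * bessel_J \<nu> x / x))"
      using int by (simp add: zero_ereal_def)
    show "((w \<circ> real_of_ereal) \<longlongrightarrow> 0) (at_right 0)"
      using w0 by (simp add: zero_ereal_def ereal_tendsto_simps)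
    show "((w \<circ> real_of_ereal) \<longlongrightarrow> 0) (at_left \<infinity>)"
      using wi by (simp add: ereal_tendsto_simps)
  qed auto
  then have "(\<nu>\<^sup>2 - \<mu>\<^sup>2) * (LBINT x:{0<..}. bessel_J \<mu> x * bessel_J \<nu> x / x) = 0"
    unfolding interval_lebesgue_integral_0_infty by (simp only: set_integral_mult_right diff_self)
  moreover have "\<nu>\<^sup>2 - \<mu>\<^sup>2 \<noteq> 0" using assms \<mu> by (auto simp: power2_eq_iff)
  ultimately show ?thesis unfolding \<mu>_def by simp
qed

section \<open>The functions \<open>j_n\<close>\<close>

lemma space_mu [simp]: "space (mu \<alpha>) = {0<..}"
  by (simp add: mu_def)

lemma borel_measurable_mu:
  fixes g :: "real \<Rightarrow> 'b::{banach, second_countable_topology}"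
  assumes "(\<lambda>x. indicator {0<..} x *\<^sub>R g x) \<in> borel_measurable borel"
  shows "g \<in> borel_measurable (mu \<alpha>)"
proof -
  have "(\<lambda>x. indicator {0<..} x *\<^sub>R g x) \<in> borel_measurable lebesgue"
    using assms by (intro measurable_completion) simp
  then show ?thesis unfolding mu_def by (simp add: borel_measurable_restrict_space_iff)
qed

lemma
  fixes g :: "real \<Rightarrow> real"
  assumes "(\<lambda>x. indicator {0<..} x * g x) \<in> borel_measurable borel"
  shows integrable_mu_iff: "integrable (mu \<alpha>) g \<longleftrightarrow>
      integrable lborel (\<lambda>x. indicator {0<..} x * (x powr (2 * \<alpha> + 1) * g x))"
    and integral_mu: "integral\<^sup>L (mu \<alpha>) g = (\<integral>x. indicator {0<..} x * (x powr (2 * \<alpha> + 1) * g x) \<partial>lborel)"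
proof -
  have m: "g \<in> borel_measurable (lebesgue_on {0<..})"
  proof -
    have "(\<lambda>x. indicator {0<..} x * g x) \<in> borel_measurable lebesgue"
      using assms by (intro measurable_completion) simp
    then show ?thesis by (subst borel_measurable_restrict_space_iff) simp_all
  qed
  have "(\<lambda>x. x powr (2 * \<alpha> + 1) * (indicator {0<..} x * g x)) \<in> borel_measurable borel"
    by (rule borel_measurable_times[OF _ assms]) simp
  also have "(\<lambda>x. x powr (2 * \<alpha> + 1) * (indicator {0<..} x * g x)) = (\<lambda>x. indicator {0<..} x * (x powr (2 * \<alpha> + 1) * g x))"
    by (simp add: mult_ac)
  finally have mb: "(\<lambda>x. indicator {0<..} x * (x powr (2 * \<alpha> + 1) * g x)) \<in> borel_measurable lborel" by simp
  have "(\<lambda>x. x powr (2 * \<alpha> + 1)) \<in> borel_measurable lborel" by measurable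
  then have mp: "(\<lambda>x. x powr (2 * \<alpha> + 1)) \<in> borel_measurable (lebesgue_on {0<..})"
    by (intro measurable_restrict_space1 measurable_completion)
  show "integrable (mu \<alpha>) g \<longleftrightarrow>
      integrable lborel (\<lambda>x. indicator {0<..} x * (x powr (2 * \<alpha> + 1) * g x))"
    unfolding mu_def using m mp mb by (simp add: integrable_density integrable_restrict_space set_integrable_def integrable_completion)
  show "integral\<^sup>L (mu \<alpha>) g = (\<integral>x. indicator {0<..} x * (x powr (2 * \<alpha> + 1) * g x) \<partial>lborel)"
    unfolding mu_def using m mp mb by (simp add: integral_density integral_restrict_space set_lebesgue_integral_def integral_completion)
qed

lemma borel_measurable_jn:
  assumes "\<alpha> > -1"
  shows "(\<lambda>x. indicator {0<..} x * jn \<alpha> n x) \<in> borel_measurable borel"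
proof -
  have "(\<lambda>x. sqrt (2 * (\<alpha> + 2 * real n + 1)) * (indicator {0<..} x * bessel_J (\<alpha> + 2 * real n + 1) x) * x powr (- \<alpha> - 1)) \<in> borel_measurable borel"
    using assms by (intro borel_measurable_times borel_measurable_bessel_J) auto
  also have "(\<lambda>x. sqrt (2 * (\<alpha> + 2 * real n + 1)) * (indicator {0<..} x * bessel_J (\<alpha> + 2 * real n + 1) x) * x powr (- \<alpha> - 1)) = (\<lambda>x. indicator {0<..} x * jn \<alpha> n x)"
    by (simp add: jn_def mult_ac)
  finally show ?thesis .
qed

lemma borel_measurable_mu_jn:
  assumes "\<alpha> > -1" shows "jn \<alpha> n \<in> borel_measurable (mu \<alpha>)"
  using borel_measurable_jn[OF assms] by (intro borel_measurable_mu) simp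

text \<open>The powers combine to x^(2\<alpha>+1) x^(-2\<alpha>-2) = 1/x, which leaves integrals of
  two Bessel functions over x; the square roots cancel the value 1/(2\<nu>) of the diagonal
  ones.\<close>

lemma jn_orthonormal:
  assumes "\<alpha> > -1"
  shows "has_bochner_integral (mu \<alpha>) (\<lambda>x. jn \<alpha> m x * jn \<alpha> n x) (if m = n then 1 else 0)"
proof -
  define \<nu> where "\<nu> = (\<lambda>n. \<alpha> + 2 * real n + 1)"
  have \<nu>: "\<nu> n > 0" for n using assms by (simp add: \<nu>_def)
  have meas: "(\<lambda>x. indicator {0<..} x * (jn \<alpha> m x * jn \<alpha> n x)) \<in> borel_measurable borel"
  proof -
    have "(\<lambda>x. (indicator {0<..} x * jn \<alpha> m x) * (indicator {0<..} x * jn \<alpha> n x)) \<in> borel_measurable borel"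
      by (intro borel_measurable_times borel_measurable_jn assms)
    also have "(\<lambda>x. (indicator {0<..} x * jn \<alpha> m x) * (indicator {0<..} x * jn \<alpha> n x)) = (\<lambda>x. indicator {0<..} x * (jn \<alpha> m x * jn \<alpha> n x))"
      by (auto simp: indicator_def)
    finally show ?thesis .
  qed
  define K where "K = sqrt (2 * \<nu> m) * sqrt (2 * \<nu> n)"
  have eq: "indicator {0<..} x * (x powr (2 * \<alpha> + 1) * (jn \<alpha> m x * jn \<alpha> n x))
    = K * (indicator {0<..} x *\<^sub>R (bessel_J (\<nu> m) x * bessel_J (\<nu> n) x / x))" for x
  proof (cases "x > 0")
    case True
    have "x powr (2 * \<alpha> + 1) * (x powr (- \<alpha> - 1) * x powr (- \<alpha> - 1)) = x powr (- 1)"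
      by (simp flip: powr_add)
    also have "\<dots> = 1 / x" using True by (simp add: powr_minus divide_inverse)
    finally have p: "x powr (2 * \<alpha> + 1) * (x powr (- \<alpha> - 1) * x powr (- \<alpha> - 1)) = 1 / x" .
    have "x powr (2 * \<alpha> + 1) * (jn \<alpha> m x * jn \<alpha> n x)
       = K * (bessel_J (\<nu> m) x * bessel_J (\<nu> n) x) * (x powr (2 * \<alpha> + 1) * (x powr (- \<alpha> - 1) * x powr (- \<alpha> - 1)))"
      by (simp only: jn_def K_def \<nu>_def mult_ac)
    then show ?thesis using True unfolding p by simp
  qed simp
  have "(\<integral>x. indicator {0<..} x *\<^sub>R (bessel_J (\<nu> m) x * bessel_J (\<nu> n) x / x) \<partial>lborel) = (if m = n then 1 / (2 * \<nu> n) else 0)"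
  proof (cases m n rule: linorder_cases)
    case less
    then have "\<nu> n = \<nu> m + 2 * real (n - m)" by (simp add: \<nu>_def of_nat_diff)
    with bessel_J_orthogonal[OF \<nu>[of m], of "n - m"] less show ?thesis
      by (simp add: set_lebesgue_integral_def mult.commute)
  next
    case greater
    then have "\<nu> m = \<nu> n + 2 * real (m - n)" by (simp add: \<nu>_def of_nat_diff)
    with bessel_J_orthogonal[OF \<nu>[of n], of "m - n"] greater show ?thesis
      by (simp add: set_lebesgue_integral_def)
  next
    case equal
    then show ?thesis using has_bochner_integral_integral_eq[OF bessel_J_square_integral[OF \<nu>[of n]]]
      by (simp add: power2_eq_square)
  qed
  then have "(\<integral>x. indicator {0<..} x * (x powr (2 * \<alpha> + 1) * (jn \<alpha> m x * jn \<alpha> n x)) \<partial>lborel) = (if m = n then 1 else 0)"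
    unfolding eq using \<nu>[of n] by (subst integral_mult_right_zero) (simp only: K_def, simp)
  moreover have "integrable lborel (\<lambda>x. indicator {0<..} x * (x powr (2 * \<alpha> + 1) * (jn \<alpha> m x * jn \<alpha> n x)))"
    unfolding eq using bessel_J_product_integrable[OF \<nu> \<nu>] unfolding set_integrable_def by (intro integrable_mult_right)
  ultimately show ?thesis using integrable_mu_iff[OF meas, of \<alpha>] integral_mu[OF meas, of \<alpha>] by (simp add: has_bochner_integral_iff)
qed

section \<open>Pointwise bounds on j_n: for large x, for fixed x, and near 0\<close>

lemma sqrt_le_exp: "x \<ge> 0 \<Longrightarrow> sqrt (2 * x) \<le> exp x"
proof -
  assume "x \<ge> 0"
  have "2 * x \<le> exp (2 * x)" using exp_ge_add_one_self[of "2 * x"] by linarith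
  also have "\<dots> = (exp x)\<^sup>2" by (simp add: exp_double)
  finally show ?thesis by (intro real_le_lsqrt) auto
qed

lemma abs_jn_le_powr:
  assumes "\<alpha> > -1" "x > 0"
  shows "\<bar>jn \<alpha> n x\<bar> \<le> exp (4 * (\<alpha> + 2 * real n + 1) + 4) * x powr (- \<alpha> - 3 / 2)"
proof -
  define \<nu> where "\<nu> = \<alpha> + 2 * real n + 1"
  have \<nu>: "\<nu> \<ge> 0" using assms by (simp add: \<nu>_def)
  have "\<bar>jn \<alpha> n x\<bar> = sqrt (2 * \<nu>) * \<bar>bessel_J \<nu> x\<bar> * x powr (- \<alpha> - 1)"
    using \<nu> by (simp add: jn_def abs_mult \<nu>_def)
  also have "\<dots> \<le> exp \<nu> * (exp (3 * \<nu> + 4) * x powr (- 1 / 2)) * x powr (- \<alpha> - 1)"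
    using \<nu> assms by (intro mult_mono sqrt_le_exp bessel_J_decay) auto
  also have "\<dots> = (exp \<nu> * exp (3 * \<nu> + 4)) * (x powr (- 1 / 2) * x powr (- \<alpha> - 1))" by (simp only: mult_ac)
  also have "exp \<nu> * exp (3 * \<nu> + 4) = exp (4 * \<nu> + 4)" by (simp flip: exp_add)
  also have "x powr (- 1 / 2) * x powr (- \<alpha> - 1) = x powr (- \<alpha> - 3 / 2)"
    by (subst powr_add[symmetric]) (rule arg_cong[where f = "(powr) x"], simp)
  finally show ?thesis by (simp add: \<nu>_def)
qed

text \<open>\<open>y\<close> is a free parameter: \<open>powr_rGamma_le\<close> at \<open>y\<close>
  yields a geometric factor of base x/(2y) at the fixed cost exp y. A large \<open>y\<close> makes
  j_n(x) smaller than any prescribed exponential in n.\<close>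

lemma abs_jn_le:
  fixes \<alpha> x y :: real and n :: nat
  assumes "\<alpha> > -1" "x > 0" "y > 0"
  defines "\<nu> \<equiv> \<alpha> + 2 * real n + 1"
  shows "\<bar>jn \<alpha> n x\<bar> \<le> exp \<nu> * (exp y * (x / (2 * y)) powr \<nu>) * exp (x\<^sup>2 / 4) * x powr (- \<alpha> - 1)"
proof -
  have \<nu>: "\<nu> \<ge> 0" using assms by (simp add: \<nu>_def)
  have "(x / 2) powr \<nu> * rGamma (\<nu> + 1) = (x / (2 * y)) powr \<nu> * (y powr \<nu> * rGamma (\<nu> + 1))"
    using assms powr_mult[of "x / (2 * y)" y \<nu>] by (simp add: mult.assoc[symmetric])
  also have "\<dots> \<le> (x / (2 * y)) powr \<nu> * exp y"
    using \<nu> assms by (intro mult_left_mono powr_rGamma_le) auto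
  finally have 1: "(x / 2) powr \<nu> * rGamma (\<nu> + 1) \<le> exp y * (x / (2 * y)) powr \<nu>" by (simp add: mult.commute)
  have 2: "exp (x\<^sup>2 / (4 * (\<nu> + 1))) \<le> exp (x\<^sup>2 / 4)"
  proof -
    have "x\<^sup>2 / (4 * (\<nu> + 1)) \<le> x\<^sup>2 / 4" using \<nu> by (intro divide_left_mono) auto
    then show ?thesis by (simp only: exp_le_cancel_iff)
  qed
  have "\<bar>bessel_J \<nu> x\<bar> \<le> (x / 2) powr \<nu> * rGamma (\<nu> + 1) * exp (x\<^sup>2 / (4 * (\<nu> + 1)))"
    using \<nu> assms by (intro abs_bessel_J_le) auto
  also have "\<dots> \<le> (exp y * (x / (2 * y)) powr \<nu>) * exp (x\<^sup>2 / 4)"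
    using mult_mono[OF 1 2] by simp
  finally have 3: "\<bar>bessel_J \<nu> x\<bar> \<le> (exp y * (x / (2 * y)) powr \<nu>) * exp (x\<^sup>2 / 4)" .
  have "\<bar>jn \<alpha> n x\<bar> = sqrt (2 * \<nu>) * \<bar>bessel_J \<nu> x\<bar> * x powr (- \<alpha> - 1)"
    using \<nu> by (simp add: jn_def abs_mult \<nu>_def)
  also have "\<dots> \<le> exp \<nu> * ((exp y * (x / (2 * y)) powr \<nu>) * exp (x\<^sup>2 / 4)) * x powr (- \<alpha> - 1)"
    using \<nu> 3 by (intro mult_mono sqrt_le_exp) auto
  finally show ?thesis by (simp only: mult.assoc)
qed

lemma abs_jn_le_1:
  assumes "\<alpha> > -1" "x > 0" "x \<le> 1"
  shows "\<bar>jn \<alpha> n x\<bar> \<le> exp (4 * (\<alpha> + 2 * real n + 1) + 4)"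
proof -
  define \<nu> where "\<nu> = \<alpha> + 2 * real n + 1"
  have \<nu>: "\<nu> \<ge> 0" using assms by (simp add: \<nu>_def)
  \<comment> \<open>With y = 1/2 the base is x itself, so x^\<nu> cancels the singular
    x^(-\<alpha>-1) and leaves x^(2n) \<le> 1.\<close>
  have "\<bar>jn \<alpha> n x\<bar> \<le> exp \<nu> * (exp (1 / 2) * (x / (2 * (1 / 2))) powr \<nu>) * exp (x\<^sup>2 / 4) * x powr (- \<alpha> - 1)"
    unfolding \<nu>_def using assms by (intro abs_jn_le) auto
  also have "\<dots> = exp \<nu> * exp (1 / 2) * exp (x\<^sup>2 / 4) * (x powr \<nu> * x powr (- \<alpha> - 1))" by simp
  also have "x powr \<nu> * x powr (- \<alpha> - 1) = x powr (2 * real n)" by (simp add: \<nu>_def flip: powr_add)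
  also have "exp \<nu> * exp (1 / 2) * exp (x\<^sup>2 / 4) * \<dots> \<le> exp \<nu> * exp (1 / 2) * exp 1 * 1"
  proof -
    have "x\<^sup>2 \<le> 1" using assms by (simp add: power_le_one)
    then show ?thesis using assms by (intro mult_mono) (auto intro!: powr_le1)
  qed
  also have "\<dots> = exp (\<nu> + 3 / 2)" by (simp flip: exp_add)
  \<comment> \<open>Weakened to the exponential factor of \<open>abs_jn_le_powr\<close>, so that one
    constant serves all x.\<close>
  also have "\<dots> \<le> exp (4 * \<nu> + 4)" using \<nu> by simp
  finally show ?thesis by (simp add: \<nu>_def)
qed

section \<open>Coefficients of functions in \<open>L\<^sup>p\<close>\<close>

lemma integrable_lborel_of_has_integral:
  fixes f :: "real \<Rightarrow> real"
  assumes "(f has_integral I) S" "\<And>x. x \<in> S \<Longrightarrow> 0 \<le> f x"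
    and "(\<lambda>x. indicator S x * f x) \<in> borel_measurable borel"
  shows "integrable lborel (\<lambda>x. indicator S x * f x)"
proof (rule integrableI_nonneg)
  show "AE x in lborel. 0 \<le> indicator S x * f x" using assms(2) by (intro AE_I2) (auto simp: indicator_def)
  have "(\<integral>\<^sup>+ x. ennreal (indicator S x * f x) \<partial>lborel) = ennreal I"
    using nn_integral_has_integral_lebesgue[OF assms(2,1)] by simp
  then show "(\<integral>\<^sup>+ x. ennreal (indicator S x * f x) \<partial>lborel) < \<infinity>" by simp
qed (use assms(3) in simp)

text \<open>At infinity the integrand against dx is x^\<gamma>, and \<gamma> < -1 restates the
  second assumption; near 0 it is x^(2\<alpha>+1), integrable because \<alpha> > -1.\<close>

lemma integrable_mu_powr_tail:
  assumes "\<alpha> > -1" "q * (\<alpha> + 3 / 2) > 2 * \<alpha> + 2"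
  shows "integrable (mu \<alpha>) (\<lambda>x. (if x \<le> 1 then 1 else x powr (- \<alpha> - 3 / 2)) powr q)"
proof (subst integrable_mu_iff)
  define \<beta> \<gamma> where "\<beta> = 2 * \<alpha> + 1" and "\<gamma> = (- \<alpha> - 3 / 2) * q + \<beta>"
  have b: "\<beta> > -1" using assms by (simp add: \<beta>_def)
  have g: "\<gamma> < -1" using assms by (simp add: \<beta>_def \<gamma>_def algebra_simps)
  have i1: "integrable lborel (\<lambda>x. indicator {0..1} x * x powr \<beta>)"
    by (rule integrable_lborel_of_has_integral[OF has_integral_powr_from_0[OF b, of 1]]) auto
  have i2: "integrable lborel (\<lambda>x. indicator {1..} x * x powr \<gamma>)"
    by (rule integrable_lborel_of_has_integral[OF has_integral_powr_to_inf[OF g, of 1]]) auto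
  show "integrable lborel (\<lambda>x. indicator {0<..} x * (x powr (2 * \<alpha> + 1) * (if x \<le> 1 then 1 else x powr (- \<alpha> - 3 / 2)) powr q))"
  proof (rule Bochner_Integration.integrable_bound[OF Bochner_Integration.integrable_add[OF i1 i2]])
    show "AE x in lborel. norm (indicator {0<..} x * (x powr (2 * \<alpha> + 1) * (if x \<le> 1 then 1 else x powr (- \<alpha> - 3 / 2)) powr q))
      \<le> norm (indicator {0..1} x * x powr \<beta> + indicator {1..} x * x powr \<gamma>)"
    proof (rule AE_I2)
      fix x :: real
      have "x powr (2 * \<alpha> + 1) * (x powr (- \<alpha> - 3 / 2)) powr q = x powr \<gamma>"
        by (simp only: powr_powr powr_add[symmetric] \<gamma>_def \<beta>_def add.commute)
      then show "norm (indicator {0<..} x * (x powr (2 * \<alpha> + 1) * (if x \<le> 1 then 1 else x powr (- \<alpha> - 3 / 2)) powr q))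
        \<le> norm (indicator {0..1} x * x powr \<beta> + indicator {1..} x * x powr \<gamma>)"
        by (cases "x \<le> 0"; cases "x \<le> 1") (auto simp: indicator_def \<beta>_def)
    qed
  qed measurable
qed measurable

text \<open>Young's inequality without its constants: if b \<le> a^(p-1), then a^p alone dominates;
  otherwise a \<le> b^(1/(p-1)) and b^q does.\<close>

lemma mult_le_powr_add_powr:
  assumes "a \<ge> 0" "b \<ge> (0::real)" "p > 1" "q = p / (p - 1)"
  shows "a * b \<le> a powr p + b powr q"
proof (cases "b \<le> a powr (p - 1)")
  case True
  have "a * b \<le> a * a powr (p - 1)" using True assms by (intro mult_left_mono) auto
  also have "\<dots> = a powr p" using assms powr_mult_base[of a "p - 1"] by simp
  finally show ?thesis using powr_ge_zero[of b q] by linarith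
next
  case False
  then have b: "b > 0" using powr_ge_zero[of a "p - 1"] by linarith
  have "a = (a powr (p - 1)) powr (1 / (p - 1))" using assms by (simp add: powr_powr)
  also have "\<dots> \<le> b powr (1 / (p - 1))" using False assms by (intro powr_mono2) auto
  finally have "a * b \<le> b powr (1 / (p - 1)) * b powr 1" using b by (intro mult_mono) auto
  also have "\<dots> = b powr (1 / (p - 1) + 1)" by (rule powr_add[symmetric])
  also have "1 / (p - 1) + 1 = q" using assms by (simp add: divide_simps)
  finally show ?thesis using powr_ge_zero[of a p] by linarith
qed

lemma powr_norm_diff_le:
  fixes a b :: "'a::real_normed_vector"
  assumes "p > 0"
  shows "norm (a - b) powr p \<le> 2 powr p * (norm a powr p + norm b powr p)"
proof -
  have "norm (a - b) \<le> 2 * max (norm a) (norm b)" using norm_triangle_ineq4[of a b] by simp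
  then have "norm (a - b) powr p \<le> (2 * max (norm a) (norm b)) powr p" using assms by (intro powr_mono2) auto
  also have "\<dots> = 2 powr p * max (norm a) (norm b) powr p" by (simp add: powr_mult)
  also have "\<dots> \<le> 2 powr p * (norm a powr p + norm b powr p)"
    by (intro mult_left_mono) (auto simp: max_def)
  finally show ?thesis .
qed

lemma Lp_space_diff:
  assumes "f \<in> Lp_space M p" "g \<in> Lp_space M p" "p > 0"
  shows "(\<lambda>x. f x - g x) \<in> Lp_space M p"
proof -
  have [measurable]: "f \<in> borel_measurable M" "g \<in> borel_measurable M" using assms by (auto simp: Lp_space_def)
  have "integrable M (\<lambda>x. norm (f x - g x) powr p)"
  proof (rule Bochner_Integration.integrable_bound)
    show "integrable M (\<lambda>x. 2 powr p * (norm (f x) powr p + norm (g x) powr p))"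
      using assms by (auto simp: Lp_space_def)
    show "AE x in M. norm (norm (f x - g x) powr p) \<le> norm (2 powr p * (norm (f x) powr p + norm (g x) powr p))"
      using powr_norm_diff_le[OF assms(3)] by (intro AE_I2) auto
  qed measurable
  then show ?thesis by (simp add: Lp_space_def)
qed

text \<open>
  The integrand is the \<open>q\<close>-th power of a majorant of \<open>\<bar>j_n\<bar>\<close> stripped of its exponential factor. Only
  the \<open>q\<close>-th power of the dual norm is tracked, so that \<open>a b \<le> a\<^sup>p + b\<^sup>q\<close> replaces Hoelder's inequality.
\<close>

definition coef_growth :: "real \<Rightarrow> real \<Rightarrow> nat \<Rightarrow> real" where
  "coef_growth \<alpha> q n = 1 + exp (4 * (\<alpha> + 2 * real n + 1) + 4) powr q *
     (\<integral>x. (if x \<le> 1 then 1 else x powr (- \<alpha> - 3 / 2)) powr q \<partial>mu \<alpha>)"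

text \<open>The summand 1 in the definition serves this bound: it lets both terms of
  \<open>norm_coef_le\<close> share the factor \<open>coef_growth \<alpha> q n\<close>.\<close>

lemma coef_growth_ge_1: "coef_growth \<alpha> q n \<ge> 1"
  unfolding coef_growth_def by (auto intro!: integral_nonneg_AE)

lemma coef_growth_summable:
  assumes "\<alpha> > -1" "q > 0" "x > 0"
  shows "summable (\<lambda>n. coef_growth \<alpha> q n * \<bar>jn \<alpha> n x\<bar>)"
proof -
  define Q where "Q = (\<integral>x. (if x \<le> 1 then 1 else x powr (- \<alpha> - 3 / 2)) powr q \<partial>mu \<alpha>)"
  have Q: "Q \<ge> 0" unfolding Q_def by (auto intro!: integral_nonneg_AE)
  define \<nu> where "\<nu> = (\<lambda>n. \<alpha> + 2 * real n + 1)"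
  have \<nu>: "\<nu> n > 0" for n using assms by (simp add: \<nu>_def)
  \<comment> \<open>Chosen so that x/(2y) = exp(-(4q+2)): its \<nu>-th power absorbs exp(4q\<nu>)
    from \<open>coef_growth\<close> and exp \<nu> from \<open>abs_jn_le\<close> and leaves
    exp(-\<nu>), which is geometric in n.\<close>
  define y where "y = x * exp (4 * q + 2) / 2"
  have y: "y > 0" using assms by (simp add: y_def)
  define C where "C = (1 + exp (4 * q) * Q) * (exp y * exp (x\<^sup>2 / 4) * x powr (- \<alpha> - 1))"
  have xy: "(x / (2 * y)) powr t = exp (- (4 * q + 2) * t)" for t
    using assms by (simp add: y_def powr_def exp_minus ln_div algebra_simps)
  show ?thesis
  proof (rule summable_comparison_test')
    show "summable (\<lambda>n. C * (exp (- (\<alpha> + 1)) * exp (- 2) ^ n))"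
      by (intro summable_mult summable_geometric) simp
    fix n :: nat
    have e: "exp (4 * \<nu> n + 4) powr q = exp (4 * q) * exp (4 * q * \<nu> n)"
      by (simp add: powr_def algebra_simps flip: exp_add)
    have "coef_growth \<alpha> q n = 1 + exp (4 * q) * exp (4 * q * \<nu> n) * Q"
      using e by (simp add: coef_growth_def Q_def \<nu>_def)
    also have "\<dots> \<le> exp (4 * q * \<nu> n) + exp (4 * q) * exp (4 * q * \<nu> n) * Q"
      using \<nu>[of n] assms by simp
    also have "\<dots> = (1 + exp (4 * q) * Q) * exp (4 * q * \<nu> n)" by (simp add: algebra_simps)
    finally have 1: "coef_growth \<alpha> q n \<le> (1 + exp (4 * q) * Q) * exp (4 * q * \<nu> n)" .
    have 2: "\<bar>jn \<alpha> n x\<bar> \<le> exp (\<nu> n) * (exp y * (x / (2 * y)) powr (\<nu> n)) * exp (x\<^sup>2 / 4) * x powr (- \<alpha> - 1)"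
      unfolding \<nu>_def using assms y by (intro abs_jn_le)
    have "coef_growth \<alpha> q n * \<bar>jn \<alpha> n x\<bar> \<le> ((1 + exp (4 * q) * Q) * exp (4 * q * \<nu> n)) *
        (exp (\<nu> n) * (exp y * (x / (2 * y)) powr (\<nu> n)) * exp (x\<^sup>2 / 4) * x powr (- \<alpha> - 1))"
      using 1 2 Q by (intro mult_mono) auto
    also have "\<dots> = C * (exp (4 * q * \<nu> n) * exp (\<nu> n) * (x / (2 * y)) powr (\<nu> n))"
      by (simp only: C_def mult_ac)
    also have "exp (4 * q * \<nu> n) * exp (\<nu> n) * (x / (2 * y)) powr (\<nu> n) = exp (- \<nu> n)"
      unfolding xy by (simp add: algebra_simps flip: exp_add)
    also have "exp (- \<nu> n) = exp (- (\<alpha> + 1)) * exp (- 2) ^ n"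
      by (simp add: \<nu>_def algebra_simps flip: exp_add exp_of_nat_mult)
    finally show "norm (coef_growth \<alpha> q n * \<bar>jn \<alpha> n x\<bar>) \<le> C * (exp (- (\<alpha> + 1)) * exp (- 2) ^ n)"
      using coef_growth_ge_1[of \<alpha> q n] by simp
  qed
qed

text \<open>The product is split as (\<bar>f\<bar>/\<delta>) (\<delta> \<bar>j_n\<bar>). The
  additive inequality is not homogeneous, so \<delta> stays free: sending it to 0 slowly compared
  with the norm of f makes the whole bound small, as Hoelder's inequality would.\<close>

lemma
  assumes "\<alpha> > -1" "p > 1" "q = p / (p - 1)" "q * (\<alpha> + 3 / 2) > 2 * \<alpha> + 2"
    and f: "f \<in> Lp_space (mu \<alpha>) p"
  shows coef_integrable: "integrable (mu \<alpha>) (\<lambda>y. f y * of_real (jn \<alpha> n y))"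
    and norm_coef_le: "\<delta> > 0 \<Longrightarrow> norm (coef \<alpha> f n) \<le>
      (\<delta> powr (- p) * (\<integral>x. norm (f x) powr p \<partial>mu \<alpha>) + \<delta> powr q) * coef_growth \<alpha> q n"
proof -
  define h where "h = (\<lambda>x. if x \<le> 1 then 1 else x powr (- \<alpha> - 3 / 2))"
  define E where "E = exp (4 * (\<alpha> + 2 * real n + 1) + 4)"
  have h: "integrable (mu \<alpha>) (\<lambda>x. h x powr q)"
    unfolding h_def using assms by (intro integrable_mu_powr_tail)
  have fi: "integrable (mu \<alpha>) (\<lambda>x. norm (f x) powr p)" and [measurable]: "f \<in> borel_measurable (mu \<alpha>)"
    using f by (auto simp: Lp_space_def)
  have [measurable]: "jn \<alpha> n \<in> borel_measurable (mu \<alpha>)" using assms by (intro borel_measurable_mu_jn)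
  have q: "q > 0" using assms by simp
  have jh: "\<bar>jn \<alpha> n x\<bar> \<le> E * h x" if "x > 0" for x
    using abs_jn_le_1[of \<alpha> x n] abs_jn_le_powr[of \<alpha> x n] assms that by (auto simp: E_def h_def)
  have hnn: "h x \<ge> 0" for x by (simp add: h_def)
  define b where "b = (\<lambda>\<delta> x. \<delta> powr (- p) * norm (f x) powr p + \<delta> powr q * (E powr q * h x powr q))"
  have bi: "integrable (mu \<alpha>) (b \<delta>)" for \<delta>
    unfolding b_def using fi h by (intro Bochner_Integration.integrable_add integrable_mult_right) auto
  have le: "norm (f x * of_real (jn \<alpha> n x)) \<le> b \<delta> x" if "x > 0" "\<delta> > 0" for x \<delta>
  proof -
    have "norm (f x * of_real (jn \<alpha> n x)) = (norm (f x) / \<delta>) * (\<delta> * \<bar>jn \<alpha> n x\<bar>)"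
      using that by (simp add: norm_mult)
    also have "\<dots> \<le> (norm (f x) / \<delta>) powr p + (\<delta> * \<bar>jn \<alpha> n x\<bar>) powr q"
      using that assms by (intro mult_le_powr_add_powr) auto
    also have "(\<delta> * \<bar>jn \<alpha> n x\<bar>) powr q \<le> (\<delta> * (E * h x)) powr q"
      using that q jh[of x] by (intro powr_mono2 mult_left_mono) auto
    also have "(norm (f x) / \<delta>) powr p = \<delta> powr (- p) * norm (f x) powr p"
      using that by (simp add: powr_divide powr_minus_divide)
    also have "\<delta> powr (- p) * norm (f x) powr p + (\<delta> * (E * h x)) powr q = b \<delta> x"
      using that hnn[of x] by (simp add: b_def E_def powr_mult)
    finally show ?thesis by simp
  qed
  show int: "integrable (mu \<alpha>) (\<lambda>y. f y * of_real (jn \<alpha> n y))"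
  proof (rule Bochner_Integration.integrable_bound[OF bi[of 1]])
    show "AE x in mu \<alpha>. norm (f x * of_real (jn \<alpha> n x)) \<le> norm (b 1 x)"
    proof (rule AE_I2)
      fix x assume "x \<in> space (mu \<alpha>)"
      then show "norm (f x * of_real (jn \<alpha> n x)) \<le> norm (b 1 x)"
        using le[of x 1] abs_ge_self[of "b 1 x"] by simp
    qed
  qed measurable
  show "norm (coef \<alpha> f n) \<le> (\<delta> powr (- p) * (\<integral>x. norm (f x) powr p \<partial>mu \<alpha>) + \<delta> powr q) * coef_growth \<alpha> q n" if "\<delta> > 0"
  proof -
    have "norm (coef \<alpha> f n) \<le> (\<integral>x. norm (f x * of_real (jn \<alpha> n x)) \<partial>mu \<alpha>)"
      unfolding coef_def by (rule integral_norm_bound)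
    also have "\<dots> \<le> (\<integral>x. b \<delta> x \<partial>mu \<alpha>)"
      using le[OF _ that] by (intro integral_mono integrable_norm int bi) auto
    also have "\<dots> = \<delta> powr (- p) * (\<integral>x. norm (f x) powr p \<partial>mu \<alpha>) + \<delta> powr q * (E powr q * (\<integral>x. h x powr q \<partial>mu \<alpha>))"
      unfolding b_def using fi h by simp
    also have "E powr q * (\<integral>x. h x powr q \<partial>mu \<alpha>) = coef_growth \<alpha> q n - 1"
      by (simp add: coef_growth_def E_def h_def)
    also have "\<delta> powr (- p) * (\<integral>x. norm (f x) powr p \<partial>mu \<alpha>) + \<delta> powr q * (coef_growth \<alpha> q n - 1)
      \<le> \<delta> powr (- p) * (\<integral>x. norm (f x) powr p \<partial>mu \<alpha>) * coef_growth \<alpha> q n + \<delta> powr q * coef_growth \<alpha> q n"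
    proof (rule add_mono)
      have "0 \<le> (\<integral>x. norm (f x) powr p \<partial>mu \<alpha>)" by (auto intro!: integral_nonneg_AE)
      then show "\<delta> powr (- p) * (\<integral>x. norm (f x) powr p \<partial>mu \<alpha>) \<le> \<delta> powr (- p) * (\<integral>x. norm (f x) powr p \<partial>mu \<alpha>) * coef_growth \<alpha> q n"
        using mult_left_mono[OF coef_growth_ge_1[of \<alpha> q n], of "\<delta> powr (- p) * (\<integral>x. norm (f x) powr p \<partial>mu \<alpha>)"] by simp
      show "\<delta> powr q * (coef_growth \<alpha> q n - 1) \<le> \<delta> powr q * coef_growth \<alpha> q n"
        by (intro mult_left_mono) auto
    qed
    finally show ?thesis by (simp add: algebra_simps)
  qed
qed

section \<open>Fourier-Neumann series\<close>

lemma coef_diff: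
  assumes "integrable (mu \<alpha>) (\<lambda>y. f y * of_real (jn \<alpha> n y))" "integrable (mu \<alpha>) (\<lambda>y. g y * of_real (jn \<alpha> n y))"
  shows "coef \<alpha> (\<lambda>x. f x - g x) n = coef \<alpha> f n - coef \<alpha> g n"
  unfolding coef_def using assms by (simp add: left_diff_distrib)

lemma coef_jn_sum:
  assumes "\<alpha> > -1"
  shows "coef \<alpha> (\<lambda>x. \<Sum>m<N. a m * of_real (jn \<alpha> m x)) n = (if n < N then a n else 0)"
proof -
  have i: "has_bochner_integral (mu \<alpha>) (\<lambda>x. a m * of_real (jn \<alpha> m x * jn \<alpha> n x)) (a m * of_real (if m = n then 1 else 0))" for m
    by (intro has_bochner_integral_mult_right has_bochner_integral_of_real jn_orthonormal assms)
  have "has_bochner_integral (mu \<alpha>) (\<lambda>x. \<Sum>m<N. a m * of_real (jn \<alpha> m x * jn \<alpha> n x)) (\<Sum>m<N. a m * of_real (if m = n then 1 else 0))"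
    by (intro has_bochner_integral_sum i)
  moreover have "(\<Sum>m<N. a m * of_real (if m = n then 1 else 0)) = (if n < N then a n else 0)"
    by (simp add: if_distrib cong: if_cong)
  ultimately show ?thesis unfolding coef_def
    by (simp add: has_bochner_integral_iff sum_distrib_right mult.assoc)
qed

definition neumann_series :: "real \<Rightarrow> (real \<Rightarrow> complex) \<Rightarrow> real \<Rightarrow> complex" where
  "neumann_series \<alpha> f x = (\<Sum>n. coef \<alpha> f n * of_real (jn \<alpha> n x))"

lemma neumann_series_jn_span:
  assumes "\<alpha> > -1" "g \<in> jn_span \<alpha>"
  shows "neumann_series \<alpha> g x = g x"
proof -
  obtain N a where g: "g = (\<lambda>x. \<Sum>n<N. a n * of_real (jn \<alpha> n x))" using assms(2) by (auto simp: jn_span_def)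
  have "neumann_series \<alpha> g x = (\<Sum>n. if n < N then a n * of_real (jn \<alpha> n x) else 0)"
    unfolding neumann_series_def g coef_jn_sum[OF assms(1)] by (intro suminf_cong) auto
  also have "\<dots> = (\<Sum>n<N. if n < N then a n * of_real (jn \<alpha> n x) else 0)"
    by (intro suminf_finite) auto
  finally show ?thesis by (simp add: g)
qed

text \<open>General exponents treat both means at once. For 0 < r < 1 and e n \<ge> 0 the multiplier
  is at most 1, so norm (c n) is a summable majorant for Tannery's theorem.\<close>

lemma abel_mean_tendsto:
  fixes c :: "nat \<Rightarrow> complex"
  assumes "summable (\<lambda>n. norm (c n))" "\<And>n. e n \<ge> (0::real)"
  shows "((\<lambda>r. \<Sum>n. of_real (r powr e n) * c n) \<longlongrightarrow> (\<Sum>n. c n)) (at_left 1)"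
proof -
  have ev: "\<forall>\<^sub>F r in at_left (1::real). r \<in> {0<..<1}"
    by (rule eventually_at_leftI[of 0]) auto
  have lim: "((\<lambda>r. of_real (r powr e k) * c k) \<longlongrightarrow> c k) (at_left 1)" for k
  proof -
    have "((\<lambda>r::real. r powr e k) \<longlongrightarrow> 1 powr e k) (at_left 1)"
      by (intro tendsto_powr tendsto_ident_at tendsto_const) auto
    then have "((\<lambda>r. of_real (r powr e k) * c k) \<longlongrightarrow> of_real (1 powr e k) * c k) (at_left 1)"
      by (intro tendsto_mult tendsto_of_real tendsto_const)
    then show ?thesis by simp
  qed
  have bd: "\<forall>\<^sub>F (k, r) in at_top \<times>\<^sub>F at_left 1. norm (of_real (r powr e k) * c k) \<le> norm (c k)"
  proof (rule eventually_mono)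
    show "\<forall>\<^sub>F kr in at_top \<times>\<^sub>F at_left (1::real). True \<and> snd kr \<in> {0<..<1}"
      using eventually_prodI[OF always_eventually ev, of "\<lambda>_. True" at_top] by simp
    fix kr :: "nat \<times> real" assume kr: "True \<and> snd kr \<in> {0<..<1}"
    have "snd kr powr e (fst kr) \<le> 1" using kr assms(2) by (intro powr_le1) auto
    then have "snd kr powr e (fst kr) * norm (c (fst kr)) \<le> 1 * norm (c (fst kr))"
      by (intro mult_right_mono) auto
    then show "case kr of (k, r) \<Rightarrow> norm (of_real (r powr e k) * c k) \<le> norm (c k)"
      by (cases kr) (simp add: norm_mult)
  qed
  show ?thesis
    using tannerys_theorem[OF lim bd assms(1)] by simp
qed

lemma neumann_series_diff_le:
  assumes "\<alpha> > -1" "p > 1" "q = p / (p - 1)" "q * (\<alpha> + 3 / 2) > 2 * \<alpha> + 2"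
    and f: "f \<in> Lp_space (mu \<alpha>) p" and g: "g \<in> Lp_space (mu \<alpha>) p"
    and "x > 0" "\<delta> > 0"
  shows "norm (neumann_series \<alpha> f x - neumann_series \<alpha> g x) \<le>
    (\<delta> powr (- p) * (\<integral>x. norm (f x - g x) powr p \<partial>mu \<alpha>) + \<delta> powr q) * (\<Sum>n. coef_growth \<alpha> q n * \<bar>jn \<alpha> n x\<bar>)"
    and "summable (\<lambda>n. norm (coef \<alpha> f n * of_real (jn \<alpha> n x)))"
proof -
  have q: "q > 0" using assms by simp
  note A = coef_growth_summable[OF assms(1) q \<open>x > 0\<close>]
  \<comment> \<open>Stated for arbitrary \<open>h\<close>: summability is applied to f and g, the
    bound to their difference.\<close>
  have s: "summable (\<lambda>n. norm (coef \<alpha> h n * of_real (jn \<alpha> n x)))"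
    and n: "norm (\<Sum>n. coef \<alpha> h n * of_real (jn \<alpha> n x)) \<le>
      (\<delta> powr (- p) * (\<integral>x. norm (h x) powr p \<partial>mu \<alpha>) + \<delta> powr q) * (\<Sum>n. coef_growth \<alpha> q n * \<bar>jn \<alpha> n x\<bar>)"
    if h: "h \<in> Lp_space (mu \<alpha>) p" for h
  proof -
    define C where "C = \<delta> powr (- p) * (\<integral>x. norm (h x) powr p \<partial>mu \<alpha>) + \<delta> powr q"
    have le: "norm (coef \<alpha> h n * of_real (jn \<alpha> n x)) \<le> C * (coef_growth \<alpha> q n * \<bar>jn \<alpha> n x\<bar>)" for n
      using mult_right_mono[OF norm_coef_le[OF assms(1-4) h \<open>\<delta> > 0\<close>, of n], of "\<bar>jn \<alpha> n x\<bar>"]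
      by (simp add: C_def norm_mult mult.assoc)
    show s: "summable (\<lambda>n. norm (coef \<alpha> h n * of_real (jn \<alpha> n x)))"
      by (rule summable_comparison_test'[OF summable_mult[OF A, of C]]) (use le in simp)
    have "norm (\<Sum>n. coef \<alpha> h n * of_real (jn \<alpha> n x)) \<le> (\<Sum>n. C * (coef_growth \<alpha> q n * \<bar>jn \<alpha> n x\<bar>))"
      by (rule norm_suminf_le[OF le summable_mult[OF A]])
    then show "norm (\<Sum>n. coef \<alpha> h n * of_real (jn \<alpha> n x)) \<le>
      (\<delta> powr (- p) * (\<integral>x. norm (h x) powr p \<partial>mu \<alpha>) + \<delta> powr q) * (\<Sum>n. coef_growth \<alpha> q n * \<bar>jn \<alpha> n x\<bar>)"
      by (simp add: suminf_mult[OF A] C_def)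
  qed
  show "summable (\<lambda>n. norm (coef \<alpha> f n * of_real (jn \<alpha> n x)))" by (rule s[OF f])
  have "neumann_series \<alpha> f x - neumann_series \<alpha> g x = (\<Sum>n. coef \<alpha> (\<lambda>x. f x - g x) n * of_real (jn \<alpha> n x))"
    unfolding neumann_series_def
    using summable_norm_cancel[OF s[OF f]] summable_norm_cancel[OF s[OF g]]
    by (simp add: suminf_diff coef_diff[OF coef_integrable[OF assms(1-4) f] coef_integrable[OF assms(1-4) g]] left_diff_distrib)
  then show "norm (neumann_series \<alpha> f x - neumann_series \<alpha> g x) \<le>
    (\<delta> powr (- p) * (\<integral>x. norm (f x - g x) powr p \<partial>mu \<alpha>) + \<delta> powr q) * (\<Sum>n. coef_growth \<alpha> q n * \<bar>jn \<alpha> n x\<bar>)"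
    using n[OF Lp_space_diff[OF f g]] assms by simp
qed

lemma neumann_series_eq_AE:
  assumes "\<alpha> > -1" "p > 1" "q = p / (p - 1)" "q * (\<alpha> + 3 / 2) > 2 * \<alpha> + 2"
    and f: "f \<in> B_space p \<alpha>"
  shows "AE x in mu \<alpha>. neumann_series \<alpha> f x = f x"
proof -
  have fL: "f \<in> Lp_space (mu \<alpha>) p" using f by (simp add: B_space_def Lp_closure_def)
  define d where "d = (\<lambda>k. 1 / real (Suc k))"
  have d: "d k > 0" for k by (simp add: d_def)
  have d0: "d \<longlonglongrightarrow> 0" unfolding d_def by (rule lim_1_over_n[THEN LIMSEQ_Suc])
  \<comment> \<open>Accuracy (d k)^2 fits the later choice \<delta> = d k: the p-th power of the
    error is at most (d k)^(2p), so dividing by \<delta>^p still leaves (d k)^p, which tends to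
    0.\<close>
  have "\<exists>g. g \<in> jn_span \<alpha> \<inter> Lp_space (mu \<alpha>) p \<and> Lp_norm (mu \<alpha>) p (\<lambda>x. f x - g x) < (d k)\<^sup>2" for k
  proof -
    have "\<forall>\<epsilon>>0. \<exists>g \<in> jn_span \<alpha> \<inter> Lp_space (mu \<alpha>) p. Lp_norm (mu \<alpha>) p (\<lambda>x. f x - g x) < \<epsilon>"
      using f by (simp add: B_space_def Lp_closure_def)
    moreover have "(d k)\<^sup>2 > 0" using d[of k] by simp
    ultimately show ?thesis by blast
  qed
  then obtain g where g: "\<And>k. g k \<in> jn_span \<alpha>" "\<And>k. g k \<in> Lp_space (mu \<alpha>) p"
    and gn: "\<And>k. Lp_norm (mu \<alpha>) p (\<lambda>x. f x - g k x) < (d k)\<^sup>2"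
    by (metis IntE)
  define N where "N = (\<lambda>k. \<integral>x. norm (f x - g k x) powr p \<partial>mu \<alpha>)"
  have N0: "N k \<ge> 0" for k unfolding N_def by (auto intro!: integral_nonneg_AE)
  have Nd: "N k \<le> d k powr p * d k powr p" for k
  proof -
    have "N k = (N k powr (1 / p)) powr p" using assms N0[of k] by (simp add: powr_powr)
    also have "\<dots> \<le> ((d k)\<^sup>2) powr p"
      using gn[of k] assms by (intro powr_mono2) (auto simp: N_def Lp_norm_def)
    also have "\<dots> = d k powr p * d k powr p" using d[of k] by (simp add: power2_eq_square powr_mult)
    finally show ?thesis .
  qed
  have dp: "(\<lambda>k. d k powr t) \<longlonglongrightarrow> 0" if "t > 0" for t
    using d0 d that by (intro tendsto_zero_powrI[OF d0 tendsto_const]) (auto intro: less_imp_le always_eventually)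
  have q: "q > 0" using assms by simp
  have lim: "(\<lambda>k. g k x) \<longlonglongrightarrow> neumann_series \<alpha> f x" if x: "x > 0" for x
  proof (rule LIM_zero_cancel, rule Lim_null_comparison)
    define T where "T = (\<Sum>n. coef_growth \<alpha> q n * \<bar>jn \<alpha> n x\<bar>)"
    have T: "T \<ge> 0" unfolding T_def
      using coef_growth_summable[OF assms(1) q x] order_trans[OF zero_le_one coef_growth_ge_1]
      by (intro suminf_nonneg) auto
    show "\<forall>\<^sub>F k in sequentially. norm (g k x - neumann_series \<alpha> f x) \<le> (d k powr p + d k powr q) * T"
    proof (rule always_eventually, rule allI)
      fix k
      have "norm (g k x - neumann_series \<alpha> f x) = norm (neumann_series \<alpha> f x - neumann_series \<alpha> (g k) x)"
        using neumann_series_jn_span[OF assms(1) g(1)] by (simp add: norm_minus_commute)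
      also have "\<dots> \<le> (d k powr (- p) * N k + d k powr q) * T"
        unfolding N_def T_def by (intro neumann_series_diff_le assms fL g x d)
      also have "d k powr (- p) * N k \<le> d k powr (- p) * (d k powr p * d k powr p)"
        by (intro mult_left_mono Nd) auto
      also have "\<dots> = d k powr p" using d[of k] by (simp add: powr_minus)
      finally show "norm (g k x - neumann_series \<alpha> f x) \<le> (d k powr p + d k powr q) * T"
        using T by (simp add: mult_right_mono)
    qed
    show "(\<lambda>k. (d k powr p + d k powr q) * T) \<longlonglongrightarrow> 0"
      using tendsto_mult[OF tendsto_add[OF dp[of p] dp[of q]] tendsto_const, of T] assms q by simp
  qed
  have [measurable]: "f \<in> borel_measurable (mu \<alpha>)" "\<And>k. g k \<in> borel_measurable (mu \<alpha>)"
    using fL g by (auto simp: Lp_space_def)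
  define u where "u = (\<lambda>k x. ennreal (norm (f x - g k x) powr p))"
  have [measurable]: "u k \<in> borel_measurable (mu \<alpha>)" for k unfolding u_def by measurable
  have uN: "(\<integral>\<^sup>+ x. u k x \<partial>mu \<alpha>) = ennreal (N k)" for k
    unfolding u_def N_def using Lp_space_diff[OF fL g(2)] assms
    by (intro nn_integral_eq_integral) (auto simp: Lp_space_def)
  have "(\<lambda>k. d k powr p * d k powr p) \<longlonglongrightarrow> 0 * 0"
    using assms by (intro tendsto_mult dp) auto
  then have "N \<longlonglongrightarrow> 0"
    by (intro tendsto_sandwich[of "\<lambda>_. 0" N sequentially "\<lambda>k. d k powr p * d k powr p"]) (auto simp: N0 Nd)
  then have "(\<lambda>k. \<integral>\<^sup>+ x. u k x \<partial>mu \<alpha>) \<longlonglongrightarrow> 0"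
    unfolding uN using tendsto_ennrealI by fastforce
  then have "liminf (\<lambda>k. \<integral>\<^sup>+ x. u k x \<partial>mu \<alpha>) = 0"
    by (intro lim_imp_Liminf) auto
  \<comment> \<open>Fatou applied to the powers of the errors avoids choosing an almost everywhere
    convergent subsequence.\<close>
  with nn_integral_liminf[of u "mu \<alpha>"] have "(\<integral>\<^sup>+ x. liminf (\<lambda>k. u k x) \<partial>mu \<alpha>) = 0" by simp
  then have "AE x in mu \<alpha>. liminf (\<lambda>k. u k x) = 0"
    by (subst (asm) nn_integral_0_iff_AE) auto
  then show ?thesis
  proof (rule AE_mp, intro AE_I2 impI)
    fix x assume "x \<in> space (mu \<alpha>)" and l: "liminf (\<lambda>k. u k x) = 0"
    then have "x > 0" by simp
    \<comment> \<open>By \<open>lim\<close> the sequence converges at this point, so its limit is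
      the liminf, which is 0.\<close>
    have "(\<lambda>k. norm (f x - g k x) powr p) \<longlonglongrightarrow> norm (f x - neumann_series \<alpha> f x) powr p"
      using assms by (intro tendsto_powr' tendsto_norm tendsto_diff tendsto_const lim \<open>x > 0\<close>) auto
    then have "(\<lambda>k. u k x) \<longlonglongrightarrow> ennreal (norm (f x - neumann_series \<alpha> f x) powr p)"
      unfolding u_def by (rule tendsto_ennrealI)
    then have "ennreal (norm (f x - neumann_series \<alpha> f x) powr p) = 0"
      using l lim_imp_Liminf[of sequentially "\<lambda>k. u k x"] by simp
    then show "neumann_series \<alpha> f x = f x" by simp
  qed
qed

text \<open>The density is positive on the half-line, so an exceptional set that is null for
  \<open>mu \<alpha>\<close> is Lebesgue null there.\<close>

lemma AE_mu_imp_AE_lebesgue: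
  assumes "AE x in mu \<alpha>. P x"
  shows "AE x in lebesgue_on {0<..}. P x"
proof -
  have "(\<lambda>x. ennreal (x powr (2 * \<alpha> + 1))) \<in> borel_measurable lborel" by measurable
  then have "(\<lambda>x. ennreal (x powr (2 * \<alpha> + 1))) \<in> borel_measurable (lebesgue_on {0<..})"
    by (intro measurable_restrict_space1 measurable_completion)
  with assms have "AE x in lebesgue_on {0<..}. 0 < ennreal (x powr (2 * \<alpha> + 1)) \<longrightarrow> P x"
    unfolding mu_def by (simp add: AE_density)
  then show ?thesis by (rule AE_mp) (intro AE_I2, auto)
qed

theorem theorem6:
  fixes \<alpha> p :: real and f :: "real \<Rightarrow> complex"
  assumes "\<alpha> > - 1"
    and "p0 \<alpha> < p" and "ereal p < p1 \<alpha>"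
    and "f \<in> B_space p \<alpha>"
  shows "(AE x in lebesgue_on {0<..}. ((\<lambda>r. P_mean \<alpha> r f x) \<longlongrightarrow> f x) (at_left 1))
       \<and> (AE x in lebesgue_on {0<..}. ((\<lambda>r. W_mean \<alpha> r f x) \<longlongrightarrow> f x) (at_left 1))"
proof -
  have p: "p > 1"
  proof (cases "\<alpha> \<ge> - 1 / 2")
    case True
    \<comment> \<open>4 (\<alpha>+1) \<ge> 2\<alpha>+3 is exactly \<alpha> \<ge> -1/2.\<close>
    then have "1 \<le> 4 * (\<alpha> + 1) / (2 * \<alpha> + 3)" by simp
    also have "\<dots> = p0 \<alpha>" using True by (simp add: p0_def)
    finally show ?thesis using assms(2) by simp
  qed (use assms(2) in \<open>simp add: p0_def\<close>)
  \<comment> \<open>Multiplied out, the upper bound on \<open>p\<close> also covers p_1 =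
    \<infinity>: for \<alpha> \<le> -1/2 the left side is nonpositive.\<close>
  have p2: "p * (2 * \<alpha> + 1) < 4 * (\<alpha> + 1)"
  proof (cases "\<alpha> > - 1 / 2")
    case True
    then have "p < 4 * (\<alpha> + 1) / (2 * \<alpha> + 1)" using assms(3) by (simp add: p1_def)
    then show ?thesis using True by (simp add: field_simps)
  next
    case False
    then have "p * (2 * \<alpha> + 1) \<le> 0" using p by (intro mult_nonneg_nonpos) auto
    also have "0 < 4 * (\<alpha> + 1)" using assms(1) by simp
    finally show ?thesis .
  qed
  define q where "q = p / (p - 1)"
  \<comment> \<open>In terms of the dual exponent, \<open>p2\<close> says that x^(-\<alpha>-3/2) is
    q-integrable at infinity for \<open>mu \<alpha>\<close>.\<close>
  have q: "q * (\<alpha> + 3 / 2) > 2 * \<alpha> + 2"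
  proof -
    have "(2 * \<alpha> + 2) * (p - 1) < p * (\<alpha> + 3 / 2)" using p2 by (simp add: algebra_simps)
    then have "2 * \<alpha> + 2 < p * (\<alpha> + 3 / 2) / (p - 1)" using p by (simp add: pos_less_divide_eq)
    then show ?thesis by (simp add: q_def)
  qed
  have fL: "f \<in> Lp_space (mu \<alpha>) p" using assms(4) by (simp add: B_space_def Lp_closure_def)
  \<comment> \<open>The choice e n = \<alpha>+2n+1 gives P_r, and its square gives W_r.\<close>
  have mean: "((\<lambda>r. \<Sum>n. of_real (r powr e n) * coef \<alpha> f n * of_real (jn \<alpha> n x)) \<longlongrightarrow> neumann_series \<alpha> f x) (at_left 1)"
    if "x > 0" "\<And>n. e n \<ge> 0" for x and e :: "nat \<Rightarrow> real"
    unfolding neumann_series_def mult.assoc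
    by (intro abel_mean_tendsto neumann_series_diff_le(2)[OF assms(1) p q_def q fL fL that(1) zero_less_one] that(2))
  have ae: "AE x in lebesgue_on {0<..}. neumann_series \<alpha> f x = f x"
    by (intro AE_mu_imp_AE_lebesgue[where \<alpha> = \<alpha>] neumann_series_eq_AE[OF assms(1) p q_def q assms(4)])
  show ?thesis
  proof
    show "AE x in lebesgue_on {0<..}. ((\<lambda>r. P_mean \<alpha> r f x) \<longlongrightarrow> f x) (at_left 1)"
      using ae
    proof (rule AE_mp, intro AE_I2 impI)
      fix x assume "x \<in> space (lebesgue_on {0::real<..})" "neumann_series \<alpha> f x = f x"
      then show "((\<lambda>r. P_mean \<alpha> r f x) \<longlongrightarrow> f x) (at_left 1)"
        unfolding P_mean_def using mean[of x "\<lambda>n. \<alpha> + 2 * real n + 1"] assms(1) by simp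
    qed
    show "AE x in lebesgue_on {0<..}. ((\<lambda>r. W_mean \<alpha> r f x) \<longlongrightarrow> f x) (at_left 1)"
      using ae
    proof (rule AE_mp, intro AE_I2 impI)
      fix x assume "x \<in> space (lebesgue_on {0::real<..})" "neumann_series \<alpha> f x = f x"
      then show "((\<lambda>r. W_mean \<alpha> r f x) \<longlongrightarrow> f x) (at_left 1)"
        unfolding W_mean_def using mean[of x "\<lambda>n. (\<alpha> + 2 * real n + 1)\<^sup>2"] by simp
    qed
  qed
qed

end
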